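(* The linearized plasma-vacuum interface problem with frozen coefficients, i.e. problem (FC) of the context, is ill-posed (in the sense that it admits an Hadamard-type ill-posedness example, as defined in the context) if and only if the constant magnetic fields $\widehat H=(0,\widehat H_2,\widehat H_3)$ and $\widehat{\mathcal H}=(0,\widehat{\mathcal H}_2,\widehat{\mathcal H}_3)$ are collinear, $$\widehat H_2\widehat{\mathcal H}_3-\widehat H_3\widehat{\mathcal H}_2=0,$$ and the constant (frozen) coefficient $[\partial_1\hat q]$ is negative (i.e. the Rayleigh--Taylor sign condition fails): $$[\partial_1\hat q]<0 .$$ (One or both of $\widehat H$, $\widehat{\mathcal H}$ may be zero.)
   Context: Notation: $\mathbb R_+=(0,\infty)$ (time), $\mathbb R^3_\pm=\{x\in\mathbb R^3:\pm x_1>0\}$, $x'=(x_2,x_3)$. Let $\hat\rho>0$ (density), $\hat c>0$ (sound speed), $\widehat H_2,\widehat H_3,\widehat{\mathcal H}_2,\widehat{\mathcal H}_3$, $\hat a_0,\hat a_1$ and $[\partial_1\hat q]$ be given real constants, and put $\hat a=-[\partial_1\hat q]$, $\widehat H=(0,\widehat H_2,\widehat H_3)$, $\widehat{\mathcal H}=(0,\widehat{\mathcal H}_2,\widehat{\mathcal H}_3)$, $\ell^+=\widehat H_2\partial_2+\widehat H_3\partial_3$, $\ell^-=\widehat{\mathcal H}_2\partial_2+\widehat{\mathcal H}_3\partial_3$. (Here $[\partial_1\hat q]$ is the frozen value of the jump $\partial_1\hat q-\widehat{\mathcal H}\cdot\partial_1\widehat{\mathcal H}$ of the normal derivative of the total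 pressure at a point of the interface, while $\hat a_0$ and $\hat a_1$ are the frozen values of $\partial_1\hat v_1$ and $-\partial_1\widehat{\mathcal H}_1$ there; these are treated as arbitrary constants.) **Problem (FC).** The unknowns are $q$ (scalar), $v=(v_1,v_2,v_3)$, $H=(H_1,H_2,H_3)$ for $x_1>0$, the scalar potential $\xi$ for $x_1<0$, and $\varphi=\varphi(t,x')$: - in $\mathbb R_+\times\mathbb R^3_+$: $\partial_t(q-\widehat H_2H_2-\widehat H_3H_3)+\hat\rho\hat c^2\,\mathrm{div}\,v=0$, $\quad\hat\rho\,\partial_tv-\ell^+H+\nabla q=0$, $\quad\partial_tH-\ell^+v+\widehat H\,\mathrm{div}\,v=0$; - in $\mathbb R_+\times\mathbb R^3_-$: $\triangle\xi=0$; - on $\mathbb R_+\times\{x_1=0\}\times\mathbb R^2$: $\partial_t\varphi=v_1+\hat a_0\varphi$, $\quad q=\ell^-\xi+\hat a\varphi$, $\quad\partial_1\xi=\ell^-\varphi+\hat a_1\varphi$; with some initial data at $t=0$. **Hadamard-type ill-posedness example.** This is a sequence (in $n$, $n=1,2,3,\dots$ large) of non-zero (complex-valued) solutions of problem (FC) of the form $$(q_n,v_n,H_n)=(\bar q_n,\bar v_n,\bar H_n)\exp\{n(s t+\lambda^+x_1+i(\omega',x'))\}\quad(x_1>0),$$ $$\xi_n=\bar\xi_n\exp\{n(s t+\lambda^-x_1+i(\omega',x'))\}\quad(x_1<0),\qquad \varphi_n=\bar\varphi_n\exp\{n(s t+i(\omega',x'))\},$$ where the barred quantities are complex constants, $\omega'=(\omega_2,\omega_3)\in\mathbb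 R^2\setminus\{0\}$ is fixed, and $s=s(n)$, $\lambda^\pm=\lambda^\pm(n)$ are complex numbers with $\Re s>0$, $\Re\lambda^+<0$, $\Re\lambda^->0$, such that $n\,\Re s(n)\to\infty$ as $n\to\infty$; that is, the exponential factor grows infinitely as $n\to\infty$ for every fixed (however small) $t>0$. (Unstable roots with $\Re s=\mathcal O(1/n)$ do not count as ill-posedness.) *)

theory Defs
  imports "HOL-Analysis.Analysis"
begin

record fc_coeffs =
  rho_hat :: real
  c_hat :: real
  H2_hat :: real     \<comment> \<open>plasma magnetic field\<close>
  H3_hat :: real
  calH2_hat :: real  \<comment> \<open>vacuum magnetic field\<close>
  calH3_hat :: real
  a0_hat :: real
  a1_hat :: real
  jump_dq :: real    \<comment> \<open>frozen jump of the normal derivative of the total pressure\<close>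

definition a_hat :: "fc_coeffs \<Rightarrow> real" where
  "a_hat C = - jump_dq C"

definition H_hat :: "fc_coeffs \<Rightarrow> real^3" where
  "H_hat C = vector [0, H2_hat C, H3_hat C]"

definition half_plus :: "(real^3) set" where
  "half_plus = {x. 0 < x $ 1}"

definition half_minus :: "(real^3) set" where
  "half_minus = {x. x $ 1 < 0}"

text \<open>The tangential variable \<open>x' = (x\<^sub>2, x\<^sub>3)\<close> is an element of \<open>real^2\<close>, so that
  \<open>x\<^sub>2\<close> and \<open>x\<^sub>3\<close> are its components number 1 and 2.\<close>

definition tang :: "real^3 \<Rightarrow> real^2" where
  "tang x = vector [x $ 2, x $ 3]"

definition bdry :: "real^2 \<Rightarrow> real^3" where
  "bdry y = vector [0, y $ 1, y $ 2]"

definition partial :: "'n::finite \<Rightarrow> (real^'n \<Rightarrow> complex) \<Rightarrow> real^'n \<Rightarrow> complex" where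
  "partial j f x = vector_derivative (\<lambda>h. f (x + h *\<^sub>R axis j 1)) (at 0)"

definition dt :: "(real \<Rightarrow> complex) \<Rightarrow> real \<Rightarrow> complex" where
  "dt f t = vector_derivative f (at t)"

definition divergence :: "(real^3 \<Rightarrow> complex^3) \<Rightarrow> real^3 \<Rightarrow> complex" where
  "divergence v x = (\<Sum>j\<in>UNIV. partial j (\<lambda>z. v z $ j) x)"

definition laplacian :: "(real^3 \<Rightarrow> complex) \<Rightarrow> real^3 \<Rightarrow> complex" where
  "laplacian f x = (\<Sum>j\<in>UNIV. partial j (partial j f) x)"

definition ell_plus :: "fc_coeffs \<Rightarrow> (real^3 \<Rightarrow> complex) \<Rightarrow> real^3 \<Rightarrow> complex" where
  "ell_plus C f x = of_real (H2_hat C) * partial 2 f x + of_real (H3_hat C) * partial 3 f x"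

definition ell_minus :: "fc_coeffs \<Rightarrow> (real^3 \<Rightarrow> complex) \<Rightarrow> real^3 \<Rightarrow> complex" where
  "ell_minus C f x = of_real (calH2_hat C) * partial 2 f x + of_real (calH3_hat C) * partial 3 f x"

text \<open>The operator \<open>\<ell>\<^sup>-\<close> acting on functions of the tangential variable only.\<close>

definition ell_minus_tan :: "fc_coeffs \<Rightarrow> (real^2 \<Rightarrow> complex) \<Rightarrow> real^2 \<Rightarrow> complex" where
  "ell_minus_tan C f y = of_real (calH2_hat C) * partial 1 f y + of_real (calH3_hat C) * partial 2 f y"

text \<open>Boundary values on \<open>x\<^sub>1 = 0\<close> are one-sided limits from the half-space \<open>S\<close> on which
  the function is given.\<close>

definition has_trace :: "(real^3) set \<Rightarrow> (real^3 \<Rightarrow> complex) \<Rightarrow> bool" where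
  "has_trace S f \<longleftrightarrow> (\<forall>y. \<exists>b. (f \<longlongrightarrow> b) (at (bdry y) within S))"

definition trace_at :: "(real^3) set \<Rightarrow> (real^3 \<Rightarrow> complex) \<Rightarrow> real^2 \<Rightarrow> complex" where
  "trace_at S f y = Lim (at (bdry y) within S) f"

text \<open>Differentiability making all terms of the equations meaningful.  Only the values of
  \<open>q\<close>, \<open>v\<close>, \<open>H\<close> for \<open>x\<^sub>1 > 0\<close>, of \<open>\<xi>\<close> for \<open>x\<^sub>1 < 0\<close>, and of all unknowns for \<open>t > 0\<close> matter
  here and below.\<close>

definition FC_regular ::
  "(real \<Rightarrow> real^3 \<Rightarrow> complex) \<Rightarrow> (real \<Rightarrow> real^3 \<Rightarrow> complex^3) \<Rightarrow> (real \<Rightarrow> real^3 \<Rightarrow> complex^3) \<Rightarrow>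
   (real \<Rightarrow> real^3 \<Rightarrow> complex) \<Rightarrow> (real \<Rightarrow> real^2 \<Rightarrow> complex) \<Rightarrow> bool" where
  "FC_regular q v H \<xi> \<phi> \<longleftrightarrow>
     (\<lambda>(t, x). q t x) differentiable_on ({0<..} \<times> half_plus) \<and>
     (\<lambda>(t, x). v t x) differentiable_on ({0<..} \<times> half_plus) \<and>
     (\<lambda>(t, x). H t x) differentiable_on ({0<..} \<times> half_plus) \<and>
     (\<lambda>(t, y). \<phi> t y) differentiable_on ({0<..} \<times> UNIV) \<and>
     (\<forall>t>0. \<xi> t differentiable_on half_minus \<and>
        (\<forall>j. partial j (\<xi> t) differentiable_on half_minus)) \<and>
     (\<forall>t>0. has_trace half_plus (q t) \<and> has_trace half_plus (\<lambda>x. v t x $ 1) \<and>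
        (\<forall>j. has_trace half_minus (partial j (\<xi> t))))"

definition FC_plasma ::
  "fc_coeffs \<Rightarrow> (real \<Rightarrow> real^3 \<Rightarrow> complex) \<Rightarrow> (real \<Rightarrow> real^3 \<Rightarrow> complex^3) \<Rightarrow>
   (real \<Rightarrow> real^3 \<Rightarrow> complex^3) \<Rightarrow> bool" where
  "FC_plasma C q v H \<longleftrightarrow> (\<forall>t>0. \<forall>x\<in>half_plus.
     dt (\<lambda>\<tau>. q \<tau> x - of_real (H2_hat C) * H \<tau> x $ 2 - of_real (H3_hat C) * H \<tau> x $ 3) t
       + of_real (rho_hat C * (c_hat C)\<^sup>2) * divergence (v t) x = 0 \<and>
     (\<forall>k. of_real (rho_hat C) * dt (\<lambda>\<tau>. v \<tau> x $ k) t - ell_plus C (\<lambda>z. H t z $ k) x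
        + partial k (q t) x = 0) \<and>
     (\<forall>k. dt (\<lambda>\<tau>. H \<tau> x $ k) t - ell_plus C (\<lambda>z. v t z $ k) x
        + of_real (H_hat C $ k) * divergence (v t) x = 0))"

definition FC_vacuum :: "(real \<Rightarrow> real^3 \<Rightarrow> complex) \<Rightarrow> bool" where
  "FC_vacuum \<xi> \<longleftrightarrow> (\<forall>t>0. \<forall>x\<in>half_minus. laplacian (\<xi> t) x = 0)"

definition FC_interface ::
  "fc_coeffs \<Rightarrow> (real \<Rightarrow> real^3 \<Rightarrow> complex) \<Rightarrow> (real \<Rightarrow> real^3 \<Rightarrow> complex^3) \<Rightarrow>
   (real \<Rightarrow> real^3 \<Rightarrow> complex) \<Rightarrow> (real \<Rightarrow> real^2 \<Rightarrow> complex) \<Rightarrow> bool" where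
  "FC_interface C q v \<xi> \<phi> \<longleftrightarrow> (\<forall>t>0. \<forall>y.
     dt (\<lambda>\<tau>. \<phi> \<tau> y) t = trace_at half_plus (\<lambda>x. v t x $ 1) y + of_real (a0_hat C) * \<phi> t y \<and>
     trace_at half_plus (q t) y
       = trace_at half_minus (ell_minus C (\<xi> t)) y + of_real (a_hat C) * \<phi> t y \<and>
     trace_at half_minus (partial 1 (\<xi> t)) y
       = ell_minus_tan C (\<phi> t) y + of_real (a1_hat C) * \<phi> t y)"

text \<open>The initial data are unspecified and hence impose no condition.\<close>

definition FC_solution ::
  "fc_coeffs \<Rightarrow> (real \<Rightarrow> real^3 \<Rightarrow> complex) \<Rightarrow> (real \<Rightarrow> real^3 \<Rightarrow> complex^3) \<Rightarrow>
   (real \<Rightarrow> real^3 \<Rightarrow> complex^3) \<Rightarrow> (real \<Rightarrow> real^3 \<Rightarrow> complex) \<Rightarrow>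
   (real \<Rightarrow> real^2 \<Rightarrow> complex) \<Rightarrow> bool" where
  "FC_solution C q v H \<xi> \<phi> \<longleftrightarrow>
     FC_regular q v H \<xi> \<phi> \<and> FC_plasma C q v H \<and> FC_vacuum \<xi> \<and> FC_interface C q v \<xi> \<phi>"

definition wave_exp ::
  "nat \<Rightarrow> complex \<Rightarrow> complex \<Rightarrow> real^2 \<Rightarrow> real \<Rightarrow> real^3 \<Rightarrow> complex" where
  "wave_exp n s l \<omega> t x =
     exp (of_nat n * (s * of_real t + l * of_real (x $ 1) + \<i> * of_real (\<omega> \<bullet> tang x)))"

definition wave_exp_tan :: "nat \<Rightarrow> complex \<Rightarrow> real^2 \<Rightarrow> real \<Rightarrow> real^2 \<Rightarrow> complex" where
  "wave_exp_tan n s \<omega> t y = exp (of_nat n * (s * of_real t + \<i> * of_real (\<omega> \<bullet> y)))"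

definition hadamard_example ::
  "fc_coeffs \<Rightarrow> real^2 \<Rightarrow> (nat \<Rightarrow> complex) \<Rightarrow> (nat \<Rightarrow> complex) \<Rightarrow> (nat \<Rightarrow> complex) \<Rightarrow>
   (nat \<Rightarrow> complex) \<Rightarrow> (nat \<Rightarrow> complex^3) \<Rightarrow> (nat \<Rightarrow> complex^3) \<Rightarrow>
   (nat \<Rightarrow> complex) \<Rightarrow> (nat \<Rightarrow> complex) \<Rightarrow> bool" where
  "hadamard_example C \<omega> s lp lm qb vb Hb \<xi>b \<phi>b \<longleftrightarrow>
     \<omega> \<noteq> 0 \<and>
     (\<forall>\<^sub>F n in sequentially.
        Re (s n) > 0 \<and> Re (lp n) < 0 \<and> Re (lm n) > 0 \<and>
        \<not> (qb n = 0 \<and> vb n = 0 \<and> Hb n = 0 \<and> \<xi>b n = 0 \<and> \<phi>b n = 0) \<and>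
        FC_solution C
          (\<lambda>t x. qb n * wave_exp n (s n) (lp n) \<omega> t x)
          (\<lambda>t x. \<chi> k. vb n $ k * wave_exp n (s n) (lp n) \<omega> t x)
          (\<lambda>t x. \<chi> k. Hb n $ k * wave_exp n (s n) (lp n) \<omega> t x)
          (\<lambda>t x. \<xi>b n * wave_exp n (s n) (lm n) \<omega> t x)
          (\<lambda>t y. \<phi>b n * wave_exp_tan n (s n) \<omega> t y)) \<and>
     filterlim (\<lambda>n. real n * Re (s n)) at_top sequentially"

definition FC_ill_posed :: "fc_coeffs \<Rightarrow> bool" where
  "FC_ill_posed C \<longleftrightarrow>
     (\<exists>\<omega> s lp lm qb vb Hb \<xi>b \<phi>b. hadamard_example C \<omega> s lp lm qb vb Hb \<xi>b \<phi>b)"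

end

theory Submission
  imports Defs
begin

text \<open>
  Write \<open>w\<close>, \<open>w'\<close> for the products of the plasma and vacuum fields with \<open>\<omega>\<close>, \<open>a\<close> for minus the
  jump, and \<open>N = \<bar>\<omega>\<bar>\<close>.  For a mode, \<open>v\<^sub>1 = (n s - a\<^sub>0) \<phi>\<close> and \<open>N q = \<kappa> \<phi>\<close> with
  \<open>\<kappa> = a N - n w'\<^sup>2 + \<i> w' a\<^sub>1\<close>, while the plasma energy identity gives \<open>Re (q cnj v\<^sub>1) > 0\<close>, hence
  \<open>Re (\<kappa> cnj (n s - a\<^sub>0)) > 0\<close>.  The dispersion relation keeps \<open>s\<close> bounded, so for \<open>w' \<noteq> 0\<close> the term
  \<open>- n w'\<^sup>2\<close> in \<open>\<kappa>\<close> bounds \<open>n Re s\<close>.  Thus \<open>w' = 0\<close>, and then the same inequality forces \<open>a > 0\<close>.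
  If \<open>w \<noteq> 0\<close>, the dispersion relation reads \<open>n\<^sup>2 P\<^sup>2 Q = O(1)\<close>, where \<open>P\<close> and \<open>Q\<close> are quadratics in
  \<open>s\<close> with distinct purely imaginary roots, so that \<open>s\<close> lies within \<open>O(1/n)\<close> of the imaginary axis.
  Hence \<open>w = w' = 0\<close> and both fields are orthogonal to \<open>\<omega>\<close>.  Conversely, for such an \<open>\<omega>\<close> and
  \<open>a > 0\<close> the dispersion relation has a real root \<open>s > 0\<close> of order \<open>n\<^bsup>-1/2\<^esup>\<close>.
\<close>

section \<open>Calculus of exponential waves: derivatives, regularity, boundary traces\<close>

lemma vector_derivative_exp_line:
  fixes a b :: complex
  assumes "\<And>y. f y = a * exp (y *\<^sub>R b)"
  shows "vector_derivative f (at y) = f y * b"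
proof -
  have "(f has_vector_derivative a * (exp (y *\<^sub>R b) * b)) (at y)"
    unfolding assms[abs_def]
    by (intro has_vector_derivative_mult_right exp_scaleR_has_vector_derivative_right)
  then show ?thesis
    by (simp add: vector_derivative_at assms)
qed

text \<open>Symbol of the gradient on a wave, with the factor \<open>n\<close> split off so that it
  cancels from the interior equations, which are homogeneous in the derivatives.\<close>

definition wave_grad :: "complex \<Rightarrow> real^2 \<Rightarrow> complex^3" where
  "wave_grad l \<omega> = vector [l, \<i> * of_real (\<omega> $ 1), \<i> * of_real (\<omega> $ 2)]"

lemma wave_grad_nth [simp]:
  "wave_grad l \<omega> $ 1 = l" "wave_grad l \<omega> $ 2 = \<i> * of_real (\<omega> $ 1)"
  "wave_grad l \<omega> $ 3 = \<i> * of_real (\<omega> $ 2)"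
  by (simp_all add: wave_grad_def)

lemma inner_tang: "\<omega> \<bullet> tang x = \<omega> $ 1 * x $ 2 + \<omega> $ 2 * x $ 3"
  by (simp add: tang_def inner_vec_def sum_2)

lemma partial_wave:
  "partial j (\<lambda>x. c * wave_exp n s l \<omega> t x) =
    (\<lambda>x. (c * (of_nat n * wave_grad l \<omega> $ j)) * wave_exp n s l \<omega> t x)"
proof
  fix x
  have "c * wave_exp n s l \<omega> t (x + h *\<^sub>R axis j 1) =
     (c * wave_exp n s l \<omega> t x) * exp (h *\<^sub>R (of_nat n * wave_grad l \<omega> $ j))" for h
    using exhaust_3[of j]
    by (auto simp: wave_exp_def inner_tang axis_def scaleR_conv_of_real[where 'a=complex] algebra_simps simp flip: exp_add)
  from vector_derivative_exp_line[of "\<lambda>h. c * wave_exp n s l \<omega> t (x + h *\<^sub>R axis j 1)", OF this, of 0]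
  show "partial j (\<lambda>x. c * wave_exp n s l \<omega> t x) x =
     (c * (of_nat n * wave_grad l \<omega> $ j)) * wave_exp n s l \<omega> t x"
    by (simp add: partial_def)
qed

lemma partial_wave_tan:
  "partial j (\<lambda>y. c * wave_exp_tan n s \<omega> t y) =
    (\<lambda>y. (c * (of_nat n * (\<i> * of_real (\<omega> $ j)))) * wave_exp_tan n s \<omega> t y)"
proof
  fix y
  have "c * wave_exp_tan n s \<omega> t (y + h *\<^sub>R axis j 1) =
     (c * wave_exp_tan n s \<omega> t y) * exp (h *\<^sub>R (of_nat n * (\<i> * of_real (\<omega> $ j))))" for h
    using exhaust_2[of j]
    by (auto simp: wave_exp_tan_def inner_add_right inner_axis scaleR_conv_of_real[where 'a=complex] algebra_simps simp flip: exp_add)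
  from vector_derivative_exp_line[of "\<lambda>h. c * wave_exp_tan n s \<omega> t (y + h *\<^sub>R axis j 1)", OF this, of 0]
  show "partial j (\<lambda>y. c * wave_exp_tan n s \<omega> t y) y =
     (c * (of_nat n * (\<i> * of_real (\<omega> $ j)))) * wave_exp_tan n s \<omega> t y"
    by (simp add: partial_def)
qed

lemma dt_wave:
  "dt (\<lambda>\<tau>. c * wave_exp n s l \<omega> \<tau> x) t = (c * (of_nat n * s)) * wave_exp n s l \<omega> t x"
proof -
  have "c * wave_exp n s l \<omega> \<tau> x = (c * wave_exp n s l \<omega> 0 x) * exp (\<tau> *\<^sub>R (of_nat n * s))" for \<tau>
    by (auto simp: wave_exp_def scaleR_conv_of_real[where 'a=complex] algebra_simps simp flip: exp_add)
  from vector_derivative_exp_line[of "\<lambda>\<tau>. c * wave_exp n s l \<omega> \<tau> x", OF this, of t]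
  show ?thesis by (simp add: dt_def)
qed

lemma dt_wave_tan:
  "dt (\<lambda>\<tau>. c * wave_exp_tan n s \<omega> \<tau> y) t = (c * (of_nat n * s)) * wave_exp_tan n s \<omega> t y"
proof -
  have "c * wave_exp_tan n s \<omega> \<tau> y = (c * wave_exp_tan n s \<omega> 0 y) * exp (\<tau> *\<^sub>R (of_nat n * s))" for \<tau>
    by (auto simp: wave_exp_tan_def scaleR_conv_of_real[where 'a=complex] algebra_simps simp flip: exp_add)
  from vector_derivative_exp_line[of "\<lambda>\<tau>. c * wave_exp_tan n s \<omega> \<tau> y", OF this, of t]
  show ?thesis by (simp add: dt_def)
qed

lemma wave_nonzero [simp]: "wave_exp n s l \<omega> t x \<noteq> 0" "wave_exp_tan n s \<omega> t y \<noteq> 0"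
  by (simp_all add: wave_exp_def wave_exp_tan_def)

lemma wave_bdry: "wave_exp n s l \<omega> t (bdry y) = wave_exp_tan n s \<omega> t y"
  by (simp add: wave_exp_def wave_exp_tan_def bdry_def tang_def inner_vec_def sum_2)

lemma isCont_wave: "isCont (\<lambda>x. c * wave_exp n s l \<omega> t x) x"
  unfolding wave_exp_def inner_tang by (intro continuous_intros)

lemma exp_differentiable:
  fixes g :: "'a::real_normed_vector \<Rightarrow> complex"
  assumes "g differentiable (at p within S)"
  shows "(\<lambda>p. c * exp (g p)) differentiable (at p within S)"
proof -
  have "exp differentiable (at (g p))"
    unfolding differentiable_def using DERIV_exp[of "g p"] unfolding has_field_derivative_def by blast
  from differentiable_mult[OF differentiable_const differentiable_compose[OF this assms]]
  show ?thesis .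
qed

lemma differentiable_linear_compose:
  assumes "bounded_linear L" "f differentiable F"
  shows "(\<lambda>x. L (f x)) differentiable F"
  using assms bounded_linear.has_derivative unfolding differentiable_def by blast

lemma wave_differentiable:
  "(\<lambda>x. c * wave_exp n s l \<omega> t x) differentiable_on S"
  "(\<lambda>(t, x). c * wave_exp n s l \<omega> t x) differentiable_on T"
  "(\<lambda>(t, x). \<chi> k. v $ k * wave_exp n s l \<omega> t x) differentiable_on T"
  "(\<lambda>(t, y). c * wave_exp_tan n s \<omega> t y) differentiable_on U"
proof -
  have nth: "(\<lambda>p. complex_of_real (f p $ i)) differentiable F"
    if "f differentiable F" for f :: "'b::real_normed_vector \<Rightarrow> real^'n" and i F
    using that by (intro differentiable_linear_compose[OF bounded_linear_of_real]
        differentiable_linear_compose[OF bounded_linear_vec_nth])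
  have real: "(\<lambda>p. complex_of_real (f p)) differentiable F"
    if "f differentiable F" for f :: "'b::real_normed_vector \<Rightarrow> real" and F
    using that by (intro differentiable_linear_compose[OF bounded_linear_of_real])
  note fst = differentiable_linear_compose[OF bounded_linear_fst differentiable_ident]
    and snd = differentiable_linear_compose[OF bounded_linear_snd differentiable_ident]
  show "(\<lambda>x. c * wave_exp n s l \<omega> t x) differentiable_on S"
    unfolding differentiable_on_def wave_exp_def inner_tang of_real_add of_real_mult
    by (intro ballI exp_differentiable differentiable_add differentiable_mult differentiable_const
        nth differentiable_ident)
  show 1: "(\<lambda>(t, x). c * wave_exp n s l \<omega> t x) differentiable_on T" for c T
    unfolding differentiable_on_def wave_exp_def inner_tang of_real_add of_real_mult case_prod_unfold
    by (intro ballI exp_differentiable differentiable_add differentiable_mult differentiable_const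
        nth real fst snd)
  show "(\<lambda>(t, y). c * wave_exp_tan n s \<omega> t y) differentiable_on U"
    unfolding differentiable_on_def wave_exp_tan_def inner_vec_def sum_2 of_real_add of_real_mult
      case_prod_unfold inner_real_def
    by (intro ballI exp_differentiable differentiable_add differentiable_mult differentiable_const
        nth real fst snd)
  \<comment> \<open>A vector-valued wave is a fixed linear image of the scalar wave of amplitude 1,
    so its differentiability follows from the scalar case.\<close>
  have "bounded_linear (\<lambda>z. \<chi> k. v $ k * z)"
    unfolding linear_conv_bounded_linear[symmetric]
    by (intro linearI) (auto simp: vec_eq_iff algebra_simps)
  moreover have "(\<lambda>p. wave_exp n s l \<omega> (fst p) (snd p)) differentiable (at p within T)" if "p \<in> T" for p
    using 1[of 1 T] that by (simp add: differentiable_on_def case_prod_unfold)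
  ultimately show "(\<lambda>(t, x). \<chi> k. v $ k * wave_exp n s l \<omega> t x) differentiable_on T"
    unfolding differentiable_on_def case_prod_unfold
    by (intro ballI) (rule differentiable_linear_compose)
qed

text \<open>\<open>Lim\<close> returns the limit only along a nontrivial filter, so traces can be
  computed only once boundary points are known to be limit points of both half-spaces. They are
  approached along the normal, and the sign of \<open>r\<close> selects the side.\<close>

lemma bdry_limit: "at (bdry y) within half_plus \<noteq> bot" "at (bdry y) within half_minus \<noteq> bot"
proof -
  have *: "bdry y islimpt S" if "\<And>e. 0 < e \<Longrightarrow> bdry y + (r * e) *\<^sub>R axis 1 1 \<in> S" "\<bar>r\<bar> = 1" for S and r :: real
    unfolding islimpt_approachable
  proof (intro allI impI)
    fix e :: real assume "e > 0"
    then show "\<exists>x'\<in>S. x' \<noteq> bdry y \<and> dist x' (bdry y) < e"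
      using that(1)[of "e / 2"] that(2)
      by (intro bexI[of _ "bdry y + (r * (e / 2)) *\<^sub>R axis 1 1"])
        (auto simp: dist_norm abs_mult axis_eq_0_iff)
  qed
  have "bdry y islimpt half_plus" by (rule *[of 1]) (auto simp: half_plus_def bdry_def axis_def)
  moreover have "bdry y islimpt half_minus" by (rule *[of "-1"]) (auto simp: half_minus_def bdry_def axis_def)
  ultimately show "at (bdry y) within half_plus \<noteq> bot" "at (bdry y) within half_minus \<noteq> bot"
    by (auto simp: trivial_limit_within)
qed

lemma wave_tendsto:
  "((\<lambda>x. c * wave_exp n s l \<omega> t x) \<longlongrightarrow> c * wave_exp_tan n s \<omega> t y) (at (bdry y) within S)"
  using isCont_wave[where x = "bdry y" and c = c and n = n and s = s and l = l and \<omega> = \<omega> and t = t]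
  by (metis continuous_at_imp_continuous_at_within continuous_within wave_bdry)

lemma has_trace_wave: "has_trace S (\<lambda>x. c * wave_exp n s l \<omega> t x)"
  unfolding has_trace_def using wave_tendsto by blast

lemma trace_wave:
  "trace_at half_plus (\<lambda>x. c * wave_exp n s l \<omega> t x) y = c * wave_exp_tan n s \<omega> t y"
  "trace_at half_minus (\<lambda>x. c * wave_exp n s l \<omega> t x) y = c * wave_exp_tan n s \<omega> t y"
  unfolding trace_at_def by (intro tendsto_Lim bdry_limit wave_tendsto)+

section \<open>Reduction of (FC) to algebraic equations for the amplitudes\<close>

text \<open>What remains of (FC) after the exponential is cancelled. The interior equations have
  lost \<open>n\<close>; the interface conditions mix derivatives with zero-order terms and keep it,
  and this is the only source of the dependence on \<open>n\<close> exploited later.\<close>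

definition mode_eqs ::
  "fc_coeffs \<Rightarrow> real^2 \<Rightarrow> nat \<Rightarrow> complex \<Rightarrow> complex \<Rightarrow> complex \<Rightarrow>
   complex \<Rightarrow> complex^3 \<Rightarrow> complex^3 \<Rightarrow> complex \<Rightarrow> complex \<Rightarrow> bool" where
  "mode_eqs C \<omega> n s lp lm q v h \<xi> \<phi> \<longleftrightarrow>
     (let D = (\<Sum>j\<in>UNIV. wave_grad lp \<omega> $ j * v $ j);
          w = H2_hat C * \<omega> $ 1 + H3_hat C * \<omega> $ 2;
          w' = calH2_hat C * \<omega> $ 1 + calH3_hat C * \<omega> $ 2
      in s * (q - of_real (H2_hat C) * h $ 2 - of_real (H3_hat C) * h $ 3)
           + of_real (rho_hat C * (c_hat C)\<^sup>2) * D = 0 \<and>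
         (\<forall>k. of_real (rho_hat C) * s * v $ k - \<i> * of_real w * h $ k + wave_grad lp \<omega> $ k * q = 0) \<and>
         (\<forall>k. s * h $ k - \<i> * of_real w * v $ k + of_real (H_hat C $ k) * D = 0) \<and>
         (lm\<^sup>2 - of_real ((norm \<omega>)\<^sup>2)) * \<xi> = 0 \<and>
         of_nat n * s * \<phi> = v $ 1 + of_real (a0_hat C) * \<phi> \<and>
         q = of_nat n * \<i> * of_real w' * \<xi> + of_real (a_hat C) * \<phi> \<and>
         of_nat n * lm * \<xi> = of_nat n * \<i> * of_real w' * \<phi> + of_real (a1_hat C) * \<phi>)"

lemma FC_regular_wave:
  "FC_regular
     (\<lambda>t x. q * wave_exp n s lp \<omega> t x)
     (\<lambda>t x. \<chi> k. v $ k * wave_exp n s lp \<omega> t x)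
     (\<lambda>t x. \<chi> k. h $ k * wave_exp n s lp \<omega> t x)
     (\<lambda>t x. \<xi> * wave_exp n s lm \<omega> t x)
     (\<lambda>t y. \<phi> * wave_exp_tan n s \<omega> t y)"
  unfolding FC_regular_def
  by (simp add: wave_differentiable has_trace_wave partial_wave)

text \<open>Excludes vacuous quantification: the amplitude equations follow from the differential
  ones because there is at least one point at which to cancel the exponential.\<close>

lemma half_nonempty: "\<exists>x. x \<in> half_plus" "\<exists>x. x \<in> half_minus"
proof -
  have "axis 1 1 \<in> half_plus" "axis 1 (-1) \<in> half_minus"
    by (auto simp: half_plus_def half_minus_def)
  then show "\<exists>x. x \<in> half_plus" "\<exists>x. x \<in> half_minus"
    by blast+
qed

lemma FC_plasma_wave_iff:
  assumes "n > 0"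
  shows "FC_plasma C
     (\<lambda>t x. q * wave_exp n s l \<omega> t x)
     (\<lambda>t x. \<chi> k. v $ k * wave_exp n s l \<omega> t x)
     (\<lambda>t x. \<chi> k. h $ k * wave_exp n s l \<omega> t x) \<longleftrightarrow>
     (let D = (\<Sum>j\<in>UNIV. wave_grad l \<omega> $ j * v $ j);
          w = H2_hat C * \<omega> $ 1 + H3_hat C * \<omega> $ 2
      in s * (q - of_real (H2_hat C) * h $ 2 - of_real (H3_hat C) * h $ 3)
           + of_real (rho_hat C * (c_hat C)\<^sup>2) * D = 0 \<and>
         (\<forall>k. of_real (rho_hat C) * s * v $ k - \<i> * of_real w * h $ k + wave_grad l \<omega> $ k * q = 0) \<and>
         (\<forall>k. s * h $ k - \<i> * of_real w * v $ k + of_real (H_hat C $ k) * D = 0))"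
proof -
  define D where "D = (\<Sum>j\<in>UNIV. wave_grad l \<omega> $ j * v $ j)"
  define w where "w = H2_hat C * \<omega> $ 1 + H3_hat C * \<omega> $ 2"
  let ?E = "\<lambda>t x. wave_exp n s l \<omega> t x"
  have div: "divergence (\<lambda>x. \<chi> k. v $ k * ?E t x) x = of_nat n * D * ?E t x" for t x
    by (simp add: divergence_def partial_wave D_def sum_3 algebra_simps)
  have ell: "ell_plus C (\<lambda>x. c * ?E t x) x = of_nat n * (\<i> * of_real w * c) * ?E t x" for c t x
    by (simp add: ell_plus_def partial_wave w_def algebra_simps)
  have 1: "dt (\<lambda>\<tau>. q * ?E \<tau> x - of_real (H2_hat C) * (\<chi> k. h $ k * ?E \<tau> x) $ 2
      - of_real (H3_hat C) * (\<chi> k. h $ k * ?E \<tau> x) $ 3) t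
      + of_real (rho_hat C * (c_hat C)\<^sup>2) * divergence (\<lambda>x. \<chi> k. v $ k * ?E t x) x
    = of_nat n * (s * (q - of_real (H2_hat C) * h $ 2 - of_real (H3_hat C) * h $ 3)
           + of_real (rho_hat C * (c_hat C)\<^sup>2) * D) * ?E t x" (is "dt ?f t + _ = _") for t x
  proof -
    have "?f = (\<lambda>\<tau>. (q - of_real (H2_hat C) * h $ 2 - of_real (H3_hat C) * h $ 3) * ?E \<tau> x)"
      by (simp add: algebra_simps)
    then show ?thesis
      by (simp only: dt_wave div) (simp add: algebra_simps)
  qed
  have 2: "of_real (rho_hat C) * dt (\<lambda>\<tau>. (\<chi> k. v $ k * ?E \<tau> x) $ k) t
     - ell_plus C (\<lambda>z. (\<chi> k. h $ k * ?E t z) $ k) x + partial k (\<lambda>x. q * ?E t x) x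
    = of_nat n * (of_real (rho_hat C) * s * v $ k - \<i> * of_real w * h $ k + wave_grad l \<omega> $ k * q)
        * ?E t x" for t x k
    by (simp add: dt_wave ell partial_wave algebra_simps)
  have 3: "dt (\<lambda>\<tau>. (\<chi> k. h $ k * ?E \<tau> x) $ k) t
     - ell_plus C (\<lambda>z. (\<chi> k. v $ k * ?E t z) $ k) x
     + of_real (H_hat C $ k) * divergence (\<lambda>x. \<chi> k. v $ k * ?E t x) x
    = of_nat n * (s * h $ k - \<i> * of_real w * v $ k + of_real (H_hat C $ k) * D) * ?E t x" for t x k
    by (simp add: dt_wave ell div algebra_simps)
  show ?thesis
    unfolding FC_plasma_def 1 2 3 Let_def D_def[symmetric] w_def[symmetric]
    using assms by (simp add: half_nonempty gt_ex)
qed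

lemma FC_vacuum_wave_iff:
  assumes "n > 0"
  shows "FC_vacuum (\<lambda>t x. \<xi> * wave_exp n s l \<omega> t x) \<longleftrightarrow> (l\<^sup>2 - of_real ((norm \<omega>)\<^sup>2)) * \<xi> = 0"
proof -
  have n: "(norm \<omega>)\<^sup>2 = (\<omega> $ 1)\<^sup>2 + (\<omega> $ 2)\<^sup>2"
    unfolding power2_norm_eq_inner by (simp add: inner_vec_def sum_2 power2_eq_square)
  have "laplacian (\<lambda>x. \<xi> * wave_exp n s l \<omega> t x) x
     = (of_nat n)\<^sup>2 * ((l\<^sup>2 - of_real ((norm \<omega>)\<^sup>2)) * \<xi>) * wave_exp n s l \<omega> t x" for t x
    unfolding laplacian_def partial_wave sum_3 n by (simp add: algebra_simps power2_eq_square)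
  then show ?thesis
    unfolding FC_vacuum_def using assms by (simp add: half_nonempty gt_ex)
qed

lemma FC_interface_wave_iff:
  "FC_interface C
     (\<lambda>t x. q * wave_exp n s lp \<omega> t x)
     (\<lambda>t x. \<chi> k. v $ k * wave_exp n s lp \<omega> t x)
     (\<lambda>t x. \<xi> * wave_exp n s lm \<omega> t x)
     (\<lambda>t y. \<phi> * wave_exp_tan n s \<omega> t y) \<longleftrightarrow>
   (let w' = calH2_hat C * \<omega> $ 1 + calH3_hat C * \<omega> $ 2 in
     of_nat n * s * \<phi> = v $ 1 + of_real (a0_hat C) * \<phi> \<and>
     q = of_nat n * \<i> * of_real w' * \<xi> + of_real (a_hat C) * \<phi> \<and>
     of_nat n * lm * \<xi> = of_nat n * \<i> * of_real w' * \<phi> + of_real (a1_hat C) * \<phi>)"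
proof -
  define w' where "w' = calH2_hat C * \<omega> $ 1 + calH3_hat C * \<omega> $ 2"
  let ?E = "\<lambda>t x. wave_exp n s lm \<omega> t x"
  let ?T = "\<lambda>t y. wave_exp_tan n s \<omega> t y"
  have ell: "ell_minus C (\<lambda>x. \<xi> * ?E t x) = (\<lambda>x. of_nat n * \<i> * of_real w' * \<xi> * ?E t x)" for t
    by (simp add: ell_minus_def fun_eq_iff partial_wave w'_def algebra_simps)
  have ell': "ell_minus_tan C (\<lambda>x. \<phi> * ?T t x) y = of_nat n * \<i> * of_real w' * \<phi> * ?T t y" for t y
    by (simp add: ell_minus_tan_def partial_wave_tan w'_def algebra_simps)
  have 1: "a * ?T t y = b * ?T t y + r * (c * ?T t y) \<longleftrightarrow> a = b + r * c" for a b c r t y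
    using wave_nonzero(2)[of n s \<omega> t y]
    by (metis (no_types, lifting) distrib_right mult.assoc mult_right_cancel)
  show ?thesis
    unfolding FC_interface_def vec_lambda_beta dt_wave_tan ell ell' partial_wave trace_wave 1
      Let_def w'_def[symmetric]
    by (simp add: half_nonempty gt_ex mult_ac)
qed

lemma FC_solution_wave_iff:
  assumes "n > 0"
  shows "FC_solution C
     (\<lambda>t x. q * wave_exp n s lp \<omega> t x)
     (\<lambda>t x. \<chi> k. v $ k * wave_exp n s lp \<omega> t x)
     (\<lambda>t x. \<chi> k. h $ k * wave_exp n s lp \<omega> t x)
     (\<lambda>t x. \<xi> * wave_exp n s lm \<omega> t x)
     (\<lambda>t y. \<phi> * wave_exp_tan n s \<omega> t y) \<longleftrightarrow> mode_eqs C \<omega> n s lp lm q v h \<xi> \<phi>"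
  unfolding FC_solution_def mode_eqs_def
  by (simp add: FC_regular_wave FC_plasma_wave_iff FC_vacuum_wave_iff FC_interface_wave_iff assms Let_def)

section \<open>Algebra of plasma modes: bounds for quadratics, elimination, energy\<close>

text \<open>For \<open>Re s > 0\<close> the imaginary part vanishes only for real \<open>s\<close>,
  and there the value is positive.\<close>

lemma quadratic_nonzero:
  assumes "Re s > 0" "A > 0" "B \<ge> 0"
  shows "of_real A * s\<^sup>2 + of_real B \<noteq> 0"
proof
  assume 0: "of_real A * s\<^sup>2 + of_real B = 0"
  have "Im (of_real A * s\<^sup>2 + of_real B) = 2 * A * Re s * Im s"
    by (simp add: power2_eq_square)
  with 0 assms have "Im s = 0"
    by simp
  moreover have "Re (of_real A * s\<^sup>2 + of_real B) = A * ((Re s)\<^sup>2 - (Im s)\<^sup>2) + B"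
    by (simp add: power2_eq_square)
  ultimately have "A * (Re s)\<^sup>2 + B = 0"
    using 0 by simp
  with assms show False
    by (smt (verit) mult_pos_pos zero_less_power)
qed

text \<open>In the factorization with roots \<open>\<i> * b\<close> and \<open>- \<i> * b\<close>,
  both factors have modulus at least \<open>Re s\<close>, and one has modulus at least
  \<open>\<bar>b\<bar>\<close> because their imaginary parts differ by \<open>2 * b\<close>.\<close>

lemma norm_square_plus_square:
  assumes "Re s > 0"
  shows "\<bar>b\<bar> * Re s \<le> cmod (s\<^sup>2 + of_real (b\<^sup>2))"
proof -
  have *: "b * Re s \<le> cmod (s\<^sup>2 + of_real (b\<^sup>2))" if "b \<ge> 0" for b :: real
  proof -
    have eq: "s\<^sup>2 + of_real (b\<^sup>2) = (s + \<i> * of_real b) * (s - \<i> * of_real b)"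
      by (simp add: algebra_simps power2_eq_square)
    have re: "Re s \<le> cmod (s + \<i> * of_real b)" "Re s \<le> cmod (s - \<i> * of_real b)"
      using complex_Re_le_cmod[of "s + \<i> * of_real b"] complex_Re_le_cmod[of "s - \<i> * of_real b"]
      by simp_all
    have im: "b \<le> cmod (s + \<i> * of_real b) \<or> b \<le> cmod (s - \<i> * of_real b)"
      using abs_Im_le_cmod[of "s + \<i> * of_real b"] abs_Im_le_cmod[of "s - \<i> * of_real b"] that
      by simp linarith
    show ?thesis
      unfolding eq norm_mult using im re assms that
      by (smt (verit) mult.commute mult_mono)
  qed
  show ?thesis
    using *[of "\<bar>b\<bar>"] by simp
qed

lemma norm_quadratic_ge:
  assumes "Re s > 0" "A > 0" "B \<ge> 0"
  shows "sqrt (A * B) * Re s \<le> cmod (of_real A * s\<^sup>2 + of_real B)"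
proof -
  have "of_real A * s\<^sup>2 + of_real B = of_real A * (s\<^sup>2 + of_real ((sqrt (B / A))\<^sup>2))"
    using assms by (simp add: field_simps flip: of_real_mult of_real_power)
  then have "cmod (of_real A * s\<^sup>2 + of_real B) = A * cmod (s\<^sup>2 + of_real ((sqrt (B / A))\<^sup>2))"
    using assms by (simp only: norm_mult) simp
  moreover have "A * (sqrt (B / A) * Re s) \<le> A * cmod (s\<^sup>2 + of_real ((sqrt (B / A))\<^sup>2))"
    using norm_square_plus_square[OF assms(1), of "sqrt (B / A)"] assms by simp
  moreover have "A * sqrt (B / A) = sqrt (A * B)"
    using assms by (simp add: real_sqrt_mult real_sqrt_divide field_simps)
  ultimately show ?thesis
    by (simp add: mult.assoc[symmetric])
qed

text \<open>The element \<open>J\<close> plays the role of the imaginary unit.\<close>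

lemma plasma_elimination:
  fixes s l q v1 v2 v3 h1 h2 h3 D J w H2 H3 x2 x3 r :: "'a::field"
  assumes J: "J * J = -1"
    and D: "D = l * v1 + J * x2 * v2 + J * x3 * v3"
    and w: "w = H2 * x2 + H3 * x3"
    and e0: "s * (q - H2 * h2 - H3 * h3) + r * c\<^sup>2 * D = 0"
    and m: "r * s * v1 - J * w * h1 + l * q = 0"
      "r * s * v2 - J * w * h2 + J * x2 * q = 0"
      "r * s * v3 - J * w * h3 + J * x3 * q = 0"
    and i: "s * h1 - J * w * v1 = 0"
      "s * h2 - J * w * v2 + H2 * D = 0"
      "s * h3 - J * w * v3 + H3 * D = 0"
  shows plasma_normal_velocity: "(r * s\<^sup>2 + w\<^sup>2) * v1 + s * l * q = 0"
    and plasma_div: "r * s\<^sup>2 * D + s * (l\<^sup>2 - (x2\<^sup>2 + x3\<^sup>2)) * q = 0"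
    and plasma_velocity: "(r * s\<^sup>2 + w\<^sup>2) * v2 + J * w * H2 * D + s * J * x2 * q = 0"
      "(r * s\<^sup>2 + w\<^sup>2) * v3 + J * w * H3 * D + s * J * x3 * q = 0"
    and plasma_pressure: "r * s ^ 3 * q + (r * s\<^sup>2 * (H2\<^sup>2 + H3\<^sup>2 + r * c\<^sup>2) + w\<^sup>2 * (r * c\<^sup>2)) * D = 0"
proof -
  show 1: "(r * s\<^sup>2 + w\<^sup>2) * v1 + s * l * q = 0"
    \<comment> \<open>The momentum equation is multiplied by \<open>s\<close>, and
      \<open>s * h1\<close> is replaced through the induction equation; the other two components are
      treated alike.\<close>
    using m(1) i(1) J by algebra
  show 2: "(r * s\<^sup>2 + w\<^sup>2) * v2 + J * w * H2 * D + s * J * x2 * q = 0"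
    using m(2) i(2) J by algebra
  show 3: "(r * s\<^sup>2 + w\<^sup>2) * v3 + J * w * H3 * D + s * J * x3 * q = 0"
    using m(3) i(3) J by algebra
  \<comment> \<open>The velocity equations with weights \<open>l\<close>, \<open>J * x2\<close>,
    \<open>J * x3\<close> add up to an equation for \<open>D\<close>. Since
    \<open>J * J = -1\<close>, its two terms \<open>w\<^sup>2 * D\<close> then cancel.\<close>
  have "(r * s\<^sup>2 + w\<^sup>2) * D + J * J * w * (H2 * x2 + H3 * x3) * D
      + s * (l\<^sup>2 + J * J * (x2\<^sup>2 + x3\<^sup>2)) * q = 0"
    using 1 2 3 D by algebra
  then show "r * s\<^sup>2 * D + s * (l\<^sup>2 - (x2\<^sup>2 + x3\<^sup>2)) * q = 0"
    unfolding J w[symmetric] by (simp add: algebra_simps power2_eq_square)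
  \<comment> \<open>The energy equation and the momentum equation are both projected onto the magnetic field.\<close>
  define V where "V = H2 * v2 + H3 * v3"
  have e: "s * q - J * w * V + (H2\<^sup>2 + H3\<^sup>2 + r * c\<^sup>2) * D = 0"
    unfolding V_def using e0 i(2,3) by algebra
  have V: "(r * s\<^sup>2 + w\<^sup>2) * V + J * w * (H2\<^sup>2 + H3\<^sup>2) * D + s * J * w * q = 0"
    unfolding V_def using 2 3 w by algebra
  \<comment> \<open>Multiplying \<open>e\<close> by \<open>r * s\<^sup>2 + w\<^sup>2\<close> and
    adding \<open>J * w\<close> times the equation \<open>V\<close> removes the field-parallel
    velocity.\<close>
  show "r * s ^ 3 * q + (r * s\<^sup>2 * (H2\<^sup>2 + H3\<^sup>2 + r * c\<^sup>2) + w\<^sup>2 * (r * c\<^sup>2)) * D = 0"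
    using e V J by algebra
qed

text \<open>Multiplying the equations by the conjugates of \<open>q - H \<cdot> h\<close>, \<open>v\<close> and \<open>h\<close> symmetrizes the system,
  so that all interior terms without \<open>s\<close> are purely imaginary.\<close>

lemma plasma_energy:
  fixes s l q v1 v2 v3 h1 h2 h3 D :: complex and w H2 H3 x2 x3 r k :: real
  assumes D: "D = l * v1 + \<i> * x2 * v2 + \<i> * x3 * v3"
    and e0: "s * (q - H2 * h2 - H3 * h3) + k * D = 0"
    and m: "r * s * v1 - \<i> * w * h1 + l * q = 0"
      "r * s * v2 - \<i> * w * h2 + \<i> * x2 * q = 0"
      "r * s * v3 - \<i> * w * h3 + \<i> * x3 * q = 0"
    and i: "s * h1 - \<i> * w * v1 = 0"
      "s * h2 - \<i> * w * v2 + H2 * D = 0"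
      "s * h3 - \<i> * w * v3 + H3 * D = 0"
    and k: "k \<noteq> 0"
  shows "Re s * ((cmod (q - H2 * h2 - H3 * h3))\<^sup>2 / k
       + r * ((cmod v1)\<^sup>2 + (cmod v2)\<^sup>2 + (cmod v3)\<^sup>2)
       + ((cmod h1)\<^sup>2 + (cmod h2)\<^sup>2 + (cmod h3)\<^sup>2)) + 2 * Re l * Re (q * cnj v1) = 0"
    (is "Re s * ?E + _ = 0")
proof -
  define p where "p = q - H2 * h2 - H3 * h3"
  have p: "s * p / k + D = 0"
    using e0 k by (simp add: p_def field_simps)
  have sq: "z * cnj z = of_real ((cmod z)\<^sup>2)" for z
    using complex_norm_square[of z] by simp
  define T where "T = v1 * cnj h1 + v2 * cnj h2 + v3 * cnj h3"
  have "0 = (s * p / k + D) * cnj p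
     + (r * s * v1 - \<i> * w * h1 + l * q) * cnj v1
     + (r * s * v2 - \<i> * w * h2 + \<i> * x2 * q) * cnj v2
     + (r * s * v3 - \<i> * w * h3 + \<i> * x3 * q) * cnj v3
     + (s * h1 - \<i> * w * v1) * cnj h1
     + (s * h2 - \<i> * w * v2 + H2 * D) * cnj h2
     + (s * h3 - \<i> * w * v3 + H3 * D) * cnj h3"
    unfolding p m i by simp
  \<comment> \<open>The terms with \<open>H2 * D\<close> and \<open>H3 * D\<close> cancel against
    those in \<open>D * cnj p\<close>. The pressure gradient contributes
    \<open>- cnj (D * cnj q)\<close> except for its normal part, where \<open>l\<close> need not be
    imaginary; this leaves the flux \<open>(l + cnj l) * (q * cnj v1)\<close>.\<close>
  also have "\<dots> = s * ((p * cnj p) / k + r * (v1 * cnj v1 + v2 * cnj v2 + v3 * cnj v3)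
       + (h1 * cnj h1 + h2 * cnj h2 + h3 * cnj h3))
     + (D * cnj q - cnj (D * cnj q)) - \<i> * w * (T + cnj T) + (l + cnj l) * (q * cnj v1)"
    by (simp add: p_def D T_def algebra_simps add_divide_distrib diff_divide_distrib)
  also have "\<dots> = s * of_real ?E
     + (D * cnj q - cnj (D * cnj q)) - \<i> * w * (T + cnj T) + of_real (2 * Re l) * (q * cnj v1)"
    unfolding sq complex_add_cnj p_def[symmetric] by simp
  finally have "Re \<dots> = 0"
    by simp
  then show ?thesis
    by (simp del: of_real_add)
qed

section \<open>Dispersion relation and energy inequality of a single mode\<close>

text \<open>All amplitudes are eliminated: \<open>\<kappa> n\<close> is the factor linking
  \<open>N * q\<close> to \<open>\<phi>\<close> through the vacuum and interface conditions. The
  hypothesis \<open>growth\<close> makes \<open>Re z\<close> positive, so a nontrivial mode has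
  \<open>q\<close> and \<open>\<phi>\<close> nonzero and both can be cancelled.\<close>

lemma mode_dispersion:
  fixes C :: fc_coeffs and \<omega> :: "real^2"
  defines "w \<equiv> H2_hat C * \<omega> $ 1 + H3_hat C * \<omega> $ 2"
    and "w' \<equiv> calH2_hat C * \<omega> $ 1 + calH3_hat C * \<omega> $ 2"
    and "A \<equiv> (H2_hat C)\<^sup>2 + (H3_hat C)\<^sup>2 + rho_hat C * (c_hat C)\<^sup>2"
    and "N \<equiv> norm \<omega>"
  defines "\<kappa> n \<equiv> of_real (a_hat C * N - real n * w'\<^sup>2) + \<i> * of_real (w' * a1_hat C)"
  assumes pos: "rho_hat C > 0" "c_hat C > 0" "Re s > 0" "Re lp < 0" "Re lm > 0" "n > 0" "\<omega> \<noteq> 0"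
    and growth: "real n * Re s > \<bar>a0_hat C\<bar>"
    and nz: "\<not> (q = 0 \<and> v = 0 \<and> h = 0 \<and> \<xi> = 0 \<and> \<phi> = 0)"
    and mode: "mode_eqs C \<omega> n s lp lm q v h \<xi> \<phi>"
  shows "(of_real (rho_hat C) * s\<^sup>2 + of_real (w\<^sup>2)) * (of_nat n * s - of_real (a0_hat C)) * of_real N
           + s * lp * \<kappa> n = 0"
    and "of_real (rho_hat C) * s ^ 4
           = (of_real A * s\<^sup>2 + of_real ((c_hat C)\<^sup>2 * w\<^sup>2)) * (lp\<^sup>2 - of_real (N\<^sup>2))"
    and "Re (\<kappa> n * cnj (of_nat n * s - of_real (a0_hat C))) > 0"
proof -
  let ?r = "rho_hat C" and ?c = "c_hat C"
  define D where "D = (\<Sum>j\<in>UNIV. wave_grad lp \<omega> $ j * v $ j)"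
  define z where "z = of_nat n * s - of_real (a0_hat C)"
  have D: "D = lp * v $ 1 + \<i> * of_real (\<omega> $ 1) * v $ 2 + \<i> * of_real (\<omega> $ 2) * v $ 3"
    by (simp add: D_def sum_3)
  have w: "complex_of_real w = of_real (H2_hat C) * of_real (\<omega> $ 1) + of_real (H3_hat C) * of_real (\<omega> $ 2)"
    by (simp add: w_def)
  have e0: "s * (q - of_real (H2_hat C) * h $ 2 - of_real (H3_hat C) * h $ 3)
           + of_real (?r * ?c\<^sup>2) * D = 0"
    and mom: "\<And>k. of_real ?r * s * v $ k - \<i> * of_real w * h $ k + wave_grad lp \<omega> $ k * q = 0"
    and ind: "\<And>k. s * h $ k - \<i> * of_real w * v $ k + of_real (H_hat C $ k) * D = 0"
    and vac: "(lm\<^sup>2 - of_real (N\<^sup>2)) * \<xi> = 0"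
    and kin: "of_nat n * s * \<phi> = v $ 1 + of_real (a0_hat C) * \<phi>"
    and dyn: "q = of_nat n * \<i> * of_real w' * \<xi> + of_real (a_hat C) * \<phi>"
    and mag: "of_nat n * lm * \<xi> = of_nat n * \<i> * of_real w' * \<phi> + of_real (a1_hat C) * \<phi>"
    using mode unfolding mode_eqs_def Let_def D_def w_def w'_def N_def by blast+
  have m: "of_real ?r * s * v $ 1 - \<i> * of_real w * h $ 1 + lp * q = 0"
    "of_real ?r * s * v $ 2 - \<i> * of_real w * h $ 2 + \<i> * of_real (\<omega> $ 1) * q = 0"
    "of_real ?r * s * v $ 3 - \<i> * of_real w * h $ 3 + \<i> * of_real (\<omega> $ 2) * q = 0"
    using mom[of 1] mom[of 2] mom[of 3] by simp_all
  have i: "s * h $ 1 - \<i> * of_real w * v $ 1 = 0"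
    "s * h $ 2 - \<i> * of_real w * v $ 2 + of_real (H2_hat C) * D = 0"
    "s * h $ 3 - \<i> * of_real w * v $ 3 + of_real (H3_hat C) * D = 0"
    using ind[of 1] ind[of 2] ind[of 3] by (simp_all add: H_hat_def)
  have e0': "s * (q - of_real (H2_hat C) * h $ 2 - of_real (H3_hat C) * h $ 3)
           + of_real ?r * (of_real ?c)\<^sup>2 * D = 0"
    using e0 by simp
  note elim = plasma_normal_velocity[OF _ D w e0' m i] plasma_div[OF _ D w e0' m i]
    plasma_velocity[OF _ D w e0' m i] plasma_pressure[OF _ D w e0' m i]
  have N: "N\<^sup>2 = (\<omega> $ 1)\<^sup>2 + (\<omega> $ 2)\<^sup>2"
    unfolding N_def power2_norm_eq_inner by (simp add: inner_vec_def sum_2 power2_eq_square)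
  have s: "s \<noteq> 0" and lp: "lp \<noteq> 0" and lm: "lm \<noteq> 0"
    using pos by auto
  have nzP: "of_real ?r * s\<^sup>2 + (of_real w)\<^sup>2 \<noteq> 0"
    using quadratic_nonzero[OF pos(3,1), of "w\<^sup>2"] by simp
  have Re_z: "Re z > 0"
    using growth by (simp add: z_def)
  then have z: "z \<noteq> 0" by auto
  have v1: "v $ 1 = z * \<phi>"
    using kin by (simp add: z_def algebra_simps)
  have normal: "(of_real ?r * s\<^sup>2 + (of_real w)\<^sup>2) * v $ 1 + s * lp * q = 0"
    by (rule elim) simp
  \<comment> \<open>Without pressure, \<open>v $ 1\<close>, then \<open>\<phi>\<close>,
    \<open>\<xi>\<close>, \<open>D\<close>, the tangential velocity and the magnetic field vanish in
    turn.\<close>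
  have q: "q \<noteq> 0"
  proof
    assume q: "q = 0"
    from normal q nzP have v1_0: "v $ 1 = 0" by simp
    with v1 z have \<phi>: "\<phi> = 0" by simp
    with mag lm pos(6) have \<xi>: "\<xi> = 0" by simp
    have D_0: "D = 0"
      using elim(2) q s pos(1) by simp
    with elim(3,4) q nzP have "v $ 2 = 0" "v $ 3 = 0" by simp_all
    with v1_0 have v: "v = 0"
      by (simp add: vec_eq_iff forall_3)
    with ind D_0 s have "h = 0"
      by (simp add: vec_eq_iff)
    with nz q v \<phi> \<xi> show False by blast
  qed
  have \<phi>: "\<phi> \<noteq> 0"
    using normal v1 q s lp by auto
  \<comment> \<open>For nonzero \<open>\<xi>\<close>, the sign of \<open>Re lm\<close> selects the
    root \<open>lm = N\<close>. For \<open>\<xi> = 0\<close> nothing fixes \<open>lm\<close>, but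
    \<open>mag\<close> makes the right-hand side vanish.\<close>
  have "of_nat n * of_real N * \<xi> = (of_nat n * \<i> * of_real w' + of_real (a1_hat C)) * \<phi>"
  proof (cases "\<xi> = 0")
    case True
    with mag \<phi> show ?thesis by (simp add: algebra_simps)
  next
    case False
    with vac have "(lm - of_real N) * (lm + of_real N) = 0"
      by (simp add: algebra_simps power2_eq_square)
    moreover have "Re (lm + of_real N) > 0"
      using pos by (simp add: N_def add_pos_nonneg)
    then have "lm + of_real N \<noteq> 0" by (metis less_irrefl zero_complex.simps(1))
    ultimately have "lm = of_real N" by simp
    with mag show ?thesis by (simp add: algebra_simps)
  qed
  from arg_cong[OF this, of "\<lambda>x. \<i> * of_real w' * x"]
  have \<xi>: "of_nat n * \<i> * of_real w' * (of_real N * \<xi>)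
      = \<i> * of_real w' * ((of_nat n * \<i> * of_real w' + of_real (a1_hat C)) * \<phi>)"
    by (simp add: algebra_simps)
  have "of_real N * q = of_nat n * \<i> * of_real w' * (of_real N * \<xi>) + of_real (a_hat C * N) * \<phi>"
    by (subst dyn) (simp add: algebra_simps)
  then have Nq: "of_real N * q = \<kappa> n * \<phi>"
    unfolding \<xi> by (simp add: \<kappa>_def algebra_simps power2_eq_square)
  have "((of_real ?r * s\<^sup>2 + of_real (w\<^sup>2)) * z * of_real N + s * lp * \<kappa> n) * \<phi>
     = of_real N * ((of_real ?r * s\<^sup>2 + (of_real w)\<^sup>2) * v $ 1 + s * lp * q)"
    using Nq v1 by (simp add: algebra_simps)
  then show "(of_real ?r * s\<^sup>2 + of_real (w\<^sup>2)) * (of_nat n * s - of_real (a0_hat C)) * of_real N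
           + s * lp * \<kappa> n = 0"
    unfolding normal z_def using \<phi> by simp

  have P: "of_real ?r * s ^ 3 * q + (of_real ?r * s\<^sup>2 * of_real A + of_real (w\<^sup>2) * of_real (?r * ?c\<^sup>2)) * D = 0"
    using elim(5) by (simp add: A_def)
  have d: "of_real ?r * s\<^sup>2 * D = - (s * (lp\<^sup>2 - of_real (N\<^sup>2)) * q)"
    using elim(2) by (simp add: N add_eq_0_iff)
  \<comment> \<open>\<open>D\<close> is eliminated between \<open>P\<close> and \<open>d\<close>;
    the common factor that remains, \<open>of_real ?r * s * q\<close>, is nonzero.\<close>
  have "0 = of_real ?r * s\<^sup>2 * (of_real ?r * s ^ 3 * q)
      + (of_real A * s\<^sup>2 + of_real (?c\<^sup>2 * w\<^sup>2)) * (of_real ?r * (of_real ?r * s\<^sup>2 * D))"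
    using arg_cong[OF P, of "\<lambda>x. of_real ?r * s\<^sup>2 * x", symmetric]
    by (simp add: algebra_simps power2_eq_square power3_eq_cube)
  also have "\<dots> = (of_real ?r * s * q) * (of_real ?r * s ^ 4 -
      (of_real A * s\<^sup>2 + of_real (?c\<^sup>2 * w\<^sup>2)) * (lp\<^sup>2 - of_real (N\<^sup>2)))"
    unfolding d by (simp add: algebra_simps power2_eq_square power3_eq_cube power4_eq_xxxx)
  finally show "of_real ?r * s ^ 4
           = (of_real A * s\<^sup>2 + of_real (?c\<^sup>2 * w\<^sup>2)) * (lp\<^sup>2 - of_real (N\<^sup>2))"
    using pos(1) s q by simp

  \<comment> \<open>Of the energy only the \<open>v $ 1\<close> term is kept. It is nonzero because
    \<open>v $ 1 = z * \<phi>\<close>, and \<open>Re lp < 0\<close> passes its sign on to the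
    flux.\<close>
  have "Re s * (?r * (cmod (v $ 1))\<^sup>2) > 0"
    using pos v1 z \<phi> by simp
  also have "Re s * (?r * (cmod (v $ 1))\<^sup>2) \<le> Re s * ((cmod (q - H2_hat C * h $ 2 - H3_hat C * h $ 3))\<^sup>2 / (?r * ?c\<^sup>2)
       + ?r * ((cmod (v $ 1))\<^sup>2 + (cmod (v $ 2))\<^sup>2 + (cmod (v $ 3))\<^sup>2)
       + ((cmod (h $ 1))\<^sup>2 + (cmod (h $ 2))\<^sup>2 + (cmod (h $ 3))\<^sup>2))"
    using pos by (intro mult_left_mono) (auto simp: algebra_simps)
  also have "\<dots> = (- 2 * Re lp) * Re (q * cnj (v $ 1))"
    using plasma_energy[OF D e0 m i] pos by simp
  finally have "Re (q * cnj (v $ 1)) > 0"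
    by (rule zero_less_mult_pos) (use pos in simp)
  moreover have "N > 0"
    using pos by (simp add: N_def)
  ultimately have "0 < Re (of_real N * q * cnj (v $ 1))"
    by (simp add: mult.assoc)
  also have "of_real N * q * cnj (v $ 1) = of_real ((cmod \<phi>)\<^sup>2) * (\<kappa> n * cnj z)"
    unfolding Nq v1 complex_norm_square by simp
  finally show "Re (\<kappa> n * cnj (of_nat n * s - of_real (a0_hat C))) > 0"
    unfolding z_def by (simp add: zero_less_mult_iff)
qed

section \<open>Necessity: asymptotics of growing modes\<close>

text \<open>The left-hand side grows like \<open>cmod s ^ 6\<close>, the right-hand side at most
  like \<open>cmod s ^ 4\<close>.\<close>

lemma quartic_root_bounded:
  fixes \<rho> A B W N K :: real
  assumes "\<rho> > 0" "A > 0" "N > 0" "W \<ge> 0" "B \<ge> 0"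
  obtains R where "\<And>s. (cmod (of_real \<rho> * s\<^sup>2 + of_real W))\<^sup>2 * N\<^sup>2 * cmod (of_real A * s\<^sup>2 + of_real B)
      \<le> K * (\<rho> * cmod s ^ 4 + N\<^sup>2 * cmod (of_real A * s\<^sup>2 + of_real B)) \<Longrightarrow> cmod s \<le> R"
proof
  let ?K = "\<bar>K\<bar>"
  \<comment> \<open>The summand 1 ensures that \<open>r = (cmod s)\<^sup>2\<close> also exceeds
    \<open>R\<close>. The next two make the leading terms of the quadratics dominate, the fourth
    absorbs \<open>?K\<close> into \<open>P\<^sup>2\<close>, and the last contradicts the final
    inequality.\<close>
  define R where "R = 1 + 2 * W / \<rho> + 2 * B / A + 8 * ?K / \<rho>\<^sup>2 + 16 * ?K / (\<rho> * N\<^sup>2 * A)"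
  fix s
  assume le: "(cmod (of_real \<rho> * s\<^sup>2 + of_real W))\<^sup>2 * N\<^sup>2 * cmod (of_real A * s\<^sup>2 + of_real B)
      \<le> K * (\<rho> * cmod s ^ 4 + N\<^sup>2 * cmod (of_real A * s\<^sup>2 + of_real B))"
  show "cmod s \<le> R"
  proof (rule ccontr)
    assume "\<not> cmod s \<le> R"
    define r where "r = (cmod s)\<^sup>2"
    define P where "P = cmod (of_real \<rho> * s\<^sup>2 + of_real W)"
    define Q where "Q = cmod (of_real A * s\<^sup>2 + of_real B)"
    have terms: "2 * W / \<rho> \<ge> 0" "2 * B / A \<ge> 0" "8 * ?K / \<rho>\<^sup>2 \<ge> 0" "16 * ?K / (\<rho> * N\<^sup>2 * A) \<ge> 0"
      using assms by simp_all
    with \<open>\<not> cmod s \<le> R\<close> have "cmod s > 1"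
      unfolding R_def by linarith
    then have "1 * cmod s < cmod s * cmod s"
      by (intro mult_strict_right_mono) linarith+
    then have "r > cmod s"
      by (simp add: r_def power2_eq_square)
    with \<open>\<not> cmod s \<le> R\<close> have "r > R" by simp
    with terms have "r > 1" "r > 2 * W / \<rho>" "r > 2 * B / A" "r > 8 * ?K / \<rho>\<^sup>2"
        "r > 16 * ?K / (\<rho> * N\<^sup>2 * A)"
      unfolding R_def by linarith+
    then have r: "r > 1" "\<rho> * r > 2 * W" "A * r > 2 * B" "\<rho>\<^sup>2 * r > 8 * ?K"
        "\<rho> * N\<^sup>2 * A * r > 16 * ?K"
      using assms by (simp_all add: field_simps)
    have lower: "a * r - b \<le> cmod (of_real a * s\<^sup>2 + of_real b)" if "a > 0" "b \<ge> 0" for a b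
      using norm_diff_ineq[of "of_real a * s\<^sup>2" "of_real b"] that
      by (simp add: norm_mult norm_power r_def)
    have P: "\<rho> * r / 2 \<le> P"
      using lower[of \<rho> W] assms r unfolding P_def by simp
    have Q: "A * r / 2 \<le> Q"
      using lower[of A B] assms r unfolding Q_def by simp
    have "r \<le> r\<^sup>2"
      using r(1) by (simp add: power2_eq_square)
    then have "\<rho>\<^sup>2 * r \<le> \<rho>\<^sup>2 * r\<^sup>2"
      by (intro mult_left_mono) auto
    moreover have "(\<rho> * r / 2)\<^sup>2 \<le> P\<^sup>2"
      using P r assms by (intro power_mono) auto
    \<comment> \<open>The reserve \<open>?K\<close> moves the term \<open>?K * N\<^sup>2 * Q\<close>
      of the right-hand side to the left.\<close>
    ultimately have P2: "\<rho>\<^sup>2 * r\<^sup>2 / 8 \<le> P\<^sup>2 - ?K"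
      using r(4) by (simp add: power_mult_distrib power_divide)
    have "(\<rho>\<^sup>2 * r\<^sup>2 / 8) * (N\<^sup>2 * (A * r / 2)) \<le> (P\<^sup>2 - ?K) * (N\<^sup>2 * Q)"
    proof (intro mult_mono mult_left_mono)
      have "0 \<le> \<rho>\<^sup>2 * r\<^sup>2 / 8" by simp
      with P2 show "0 \<le> P\<^sup>2 - ?K" by linarith
    qed (use P2 Q assms r in auto)
    also have "\<dots> \<le> ?K * (\<rho> * r\<^sup>2)"
    proof -
      have "P\<^sup>2 * N\<^sup>2 * Q \<le> K * (\<rho> * r\<^sup>2 + N\<^sup>2 * Q)"
        using le unfolding P_def Q_def r_def by simp
      also have "\<dots> \<le> ?K * (\<rho> * r\<^sup>2 + N\<^sup>2 * Q)"
        using assms by (intro mult_right_mono) (auto simp: Q_def)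
      finally show ?thesis by (simp add: algebra_simps)
    qed
    finally have "(\<rho> * r\<^sup>2 / 16) * (\<rho> * N\<^sup>2 * A * r) \<le> (\<rho> * r\<^sup>2 / 16) * (16 * ?K)"
      by (simp add: power2_eq_square mult_ac)
    then have "\<rho> * N\<^sup>2 * A * r \<le> 16 * ?K"
      using assms r by (subst (asm) mult_le_cancel_left_pos) auto
    with r(5) show False by simp
  qed
qed

text \<open>The conditions of a mode are combined for large \<open>n\<close>. In the alternative in
  \<open>pos\<close>, \<open>A - \<rho> * c\<^sup>2\<close> stands for the squared plasma field,
  which is positive whenever \<open>w\<close> is nonzero.\<close>

lemma growing_modes_necessary:
  fixes s l :: "nat \<Rightarrow> complex" and \<rho> c A N a a0 a1 w w' :: real
  assumes pos: "\<rho> > 0" "c > 0" "N > 0" "A > \<rho> * c\<^sup>2 \<or> w = 0 \<and> A > 0"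
    and growth: "filterlim (\<lambda>n. real n * Re (s n)) at_top sequentially"
    and ev: "\<forall>\<^sub>F n in sequentially. Re (s n) > 0 \<and>
      (of_real \<rho> * (s n)\<^sup>2 + of_real (w\<^sup>2)) * (of_nat n * s n - of_real a0) * of_real N
        + s n * l n * (of_real (a * N - real n * w'\<^sup>2) + \<i> * of_real (w' * a1)) = 0 \<and>
      of_real \<rho> * s n ^ 4
        = (of_real A * (s n)\<^sup>2 + of_real (c\<^sup>2 * w\<^sup>2)) * ((l n)\<^sup>2 - of_real (N\<^sup>2)) \<and>
      Re ((of_real (a * N - real n * w'\<^sup>2) + \<i> * of_real (w' * a1))
        * cnj (of_nat n * s n - of_real a0)) > 0"
  shows "w = 0" "w' = 0" "a > 0"
proof -
  define \<kappa> where "\<kappa> n = of_real (a * N - real n * w'\<^sup>2) + \<i> * of_real (w' * a1)" for n :: nat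
  define P where "P n = of_real \<rho> * (s n)\<^sup>2 + of_real (w\<^sup>2)" for n
  define Q where "Q n = of_real A * (s n)\<^sup>2 + of_real (c\<^sup>2 * w\<^sup>2)" for n
  define K where "K = w'\<^sup>2 + \<bar>a\<bar> * N + \<bar>w' * a1\<bar>"
  have A: "A > 0"
    using pos by (smt (verit) mult_pos_pos zero_less_power)
  \<comment> \<open>Squaring the first relation leaves only \<open>(l n)\<^sup>2\<close>, which the
    second one expresses through \<open>s n\<close>. The factor 4 comes from
    \<open>cmod z \<ge> real n * cmod (s n) / 2\<close>, valid once \<open>real n * Re (s n)\<close>
    exceeds \<open>2 * \<bar>a0\<bar>\<close>. The last conjunct is the energy inequality in real
    terms.\<close>
  have basic: "\<forall>\<^sub>F n in sequentially. n > 0 \<and> Re (s n) > 0 \<and>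
      (cmod (P n))\<^sup>2 * (real n)\<^sup>2 * N\<^sup>2 * cmod (Q n)
        \<le> 4 * (cmod (\<kappa> n))\<^sup>2 * (\<rho> * cmod (s n) ^ 4 + N\<^sup>2 * cmod (Q n)) \<and>
      (a * N - real n * w'\<^sup>2) * (real n * Re (s n) - a0) + real n * w' * a1 * Im (s n) > 0"
    using ev eventually_gt_at_top[of 0] filterlim_at_top_dense[THEN iffD1, OF growth, rule_format, of "2 * \<bar>a0\<bar>"]
  proof eventually_elim
    case (elim n)
    define z where "z = of_nat n * s n - of_real a0"
    have eq: "P n * z * of_real N + s n * l n * \<kappa> n = 0"
      and disp: "of_real \<rho> * s n ^ 4 = Q n * ((l n)\<^sup>2 - of_real (N\<^sup>2))"
      and pos': "Re (\<kappa> n * cnj z) > 0" and s: "Re (s n) > 0"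
      using elim unfolding P_def Q_def z_def \<kappa>_def by auto
    have "P n * z * of_real N = - (s n * l n * \<kappa> n)"
      using eq by (simp add: add_eq_0_iff)
    then have "(P n * z * of_real N)\<^sup>2 = (s n)\<^sup>2 * (l n)\<^sup>2 * (\<kappa> n)\<^sup>2"
      by (simp add: power_mult_distrib)
    then have "(P n)\<^sup>2 * z\<^sup>2 * of_real (N\<^sup>2) * Q n = (s n)\<^sup>2 * (\<kappa> n)\<^sup>2 * (Q n * (l n)\<^sup>2)"
      by (simp add: power_mult_distrib)
    also have "Q n * (l n)\<^sup>2 = of_real \<rho> * s n ^ 4 + of_real (N\<^sup>2) * Q n"
      unfolding disp by (simp add: algebra_simps)
    finally have eq2: "(cmod (P n))\<^sup>2 * (cmod z)\<^sup>2 * N\<^sup>2 * cmod (Q n)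
        = (cmod (s n))\<^sup>2 * (cmod (\<kappa> n))\<^sup>2 * cmod (of_real \<rho> * s n ^ 4 + of_real (N\<^sup>2) * Q n)"
      by (metis (no_types, opaque_lifting) norm_mult norm_power norm_of_real abs_power2)
    have "cmod (of_real \<rho> * s n ^ 4 + of_real (N\<^sup>2) * Q n) \<le> \<rho> * cmod (s n) ^ 4 + N\<^sup>2 * cmod (Q n)"
      using norm_triangle_ineq[of "of_real \<rho> * s n ^ 4" "of_real (N\<^sup>2) * Q n"] pos(1)
      by (simp add: norm_mult norm_power)
    then have le1: "(cmod (P n))\<^sup>2 * (cmod z)\<^sup>2 * N\<^sup>2 * cmod (Q n)
        \<le> (cmod (s n))\<^sup>2 * (cmod (\<kappa> n))\<^sup>2 * (\<rho> * cmod (s n) ^ 4 + N\<^sup>2 * cmod (Q n))"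
      unfolding eq2 by (intro mult_left_mono) auto
    have "2 * \<bar>a0\<bar> \<le> real n * cmod (s n)"
      using elim(3) complex_Re_le_cmod[of "s n"] by (smt (verit) mult_left_mono of_nat_0_le_iff)
    then have "real n * cmod (s n) / 2 \<le> cmod z"
      using norm_triangle_ineq2[of "of_nat n * s n" "of_real a0"] by (simp add: z_def norm_mult)
    then have "(real n * cmod (s n) / 2)\<^sup>2 \<le> (cmod z)\<^sup>2"
      by (intro power_mono) auto
    then have "(cmod (P n))\<^sup>2 * (real n * cmod (s n) / 2)\<^sup>2 * N\<^sup>2 * cmod (Q n)
        \<le> (cmod (P n))\<^sup>2 * (cmod z)\<^sup>2 * N\<^sup>2 * cmod (Q n)"
      by (intro mult_right_mono mult_left_mono) auto
    with le1 have "((cmod (s n))\<^sup>2 / 4) * ((cmod (P n))\<^sup>2 * (real n)\<^sup>2 * N\<^sup>2 * cmod (Q n))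
        \<le> ((cmod (s n))\<^sup>2 / 4) * (4 * (cmod (\<kappa> n))\<^sup>2 * (\<rho> * cmod (s n) ^ 4 + N\<^sup>2 * cmod (Q n)))"
      by (simp add: power_mult_distrib power_divide mult_ac)
    moreover have "s n \<noteq> 0" using s by auto
    ultimately have "(cmod (P n))\<^sup>2 * (real n)\<^sup>2 * N\<^sup>2 * cmod (Q n)
        \<le> 4 * (cmod (\<kappa> n))\<^sup>2 * (\<rho> * cmod (s n) ^ 4 + N\<^sup>2 * cmod (Q n))"
      by (subst (asm) mult_le_cancel_left_pos) auto
    moreover have "Re (\<kappa> n * cnj z)
        = (a * N - real n * w'\<^sup>2) * (real n * Re (s n) - a0) + real n * w' * a1 * Im (s n)"
      by (simp add: \<kappa>_def z_def algebra_simps)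
    ultimately show ?case
      using elim(2) s pos' by simp
  qed
  obtain R where R: "\<And>s. (cmod (of_real \<rho> * s\<^sup>2 + of_real (w\<^sup>2)))\<^sup>2 * N\<^sup>2 * cmod (of_real A * s\<^sup>2 + of_real (c\<^sup>2 * w\<^sup>2))
      \<le> (4 * K\<^sup>2) * (\<rho> * cmod s ^ 4 + N\<^sup>2 * cmod (of_real A * s\<^sup>2 + of_real (c\<^sup>2 * w\<^sup>2))) \<Longrightarrow> cmod s \<le> R"
    using quartic_root_bounded[OF pos(1) A pos(3), of "w\<^sup>2" "c\<^sup>2 * w\<^sup>2" "4 * K\<^sup>2"] by auto
  \<comment> \<open>As \<open>cmod (\<kappa> n) \<le> K * real n\<close>, the factors
    \<open>n\<^sup>2\<close> cancel and leave an inequality independent of \<open>n\<close>.\<close>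
  have bounded: "\<forall>\<^sub>F n in sequentially. cmod (s n) \<le> R"
    using basic
  proof eventually_elim
    case (elim n)
    then have n: "real n \<ge> 1" by simp
    have "\<bar>a\<bar> * N * 1 \<le> \<bar>a\<bar> * N * real n" "\<bar>w' * a1\<bar> * 1 \<le> \<bar>w' * a1\<bar> * real n"
      using n pos(3) by (intro mult_left_mono; simp)+
    moreover have "cmod (\<kappa> n) \<le> (\<bar>a\<bar> * N + real n * w'\<^sup>2) + \<bar>w' * a1\<bar>"
    proof -
      have "cmod (\<kappa> n) \<le> \<bar>a * N - real n * w'\<^sup>2\<bar> + \<bar>w' * a1\<bar>"
        unfolding \<kappa>_def using norm_triangle_ineq[of "of_real (a * N - real n * w'\<^sup>2)" "\<i> * of_real (w' * a1)"]
        by (simp only: norm_mult norm_of_real norm_ii mult_1_left)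
      also have "\<bar>a * N - real n * w'\<^sup>2\<bar> \<le> \<bar>a\<bar> * N + real n * w'\<^sup>2"
        using abs_triangle_ineq4[of "a * N" "real n * w'\<^sup>2"] pos(3) by (simp add: abs_mult)
      finally show ?thesis by simp
    qed
    ultimately have "cmod (\<kappa> n) \<le> K * real n"
      unfolding K_def by (simp add: algebra_simps)
    then have "(cmod (\<kappa> n))\<^sup>2 \<le> (K * real n)\<^sup>2"
      by (intro power_mono) auto
    then have mono: "4 * (cmod (\<kappa> n))\<^sup>2 * (\<rho> * cmod (s n) ^ 4 + N\<^sup>2 * cmod (Q n))
        \<le> 4 * (K * real n)\<^sup>2 * (\<rho> * cmod (s n) ^ 4 + N\<^sup>2 * cmod (Q n))"
      using pos(1) by (intro mult_right_mono mult_left_mono) auto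
    have "(real n)\<^sup>2 * ((cmod (P n))\<^sup>2 * N\<^sup>2 * cmod (Q n)) = (cmod (P n))\<^sup>2 * (real n)\<^sup>2 * N\<^sup>2 * cmod (Q n)"
      by simp
    also have "\<dots> \<le> 4 * (cmod (\<kappa> n))\<^sup>2 * (\<rho> * cmod (s n) ^ 4 + N\<^sup>2 * cmod (Q n))"
      using elim by blast
    also note mono
    also have "4 * (K * real n)\<^sup>2 * (\<rho> * cmod (s n) ^ 4 + N\<^sup>2 * cmod (Q n))
        = (real n)\<^sup>2 * ((4 * K\<^sup>2) * (\<rho> * cmod (s n) ^ 4 + N\<^sup>2 * cmod (Q n)))"
      by (simp add: power_mult_distrib)
    finally have "(real n)\<^sup>2 * ((cmod (P n))\<^sup>2 * N\<^sup>2 * cmod (Q n))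
        \<le> (real n)\<^sup>2 * ((4 * K\<^sup>2) * (\<rho> * cmod (s n) ^ 4 + N\<^sup>2 * cmod (Q n)))" .
    then have "(cmod (P n))\<^sup>2 * N\<^sup>2 * cmod (Q n) \<le> (4 * K\<^sup>2) * (\<rho> * cmod (s n) ^ 4 + N\<^sup>2 * cmod (Q n))"
      using n by (subst (asm) mult_le_cancel_left_pos) auto
    then show ?case
      unfolding P_def Q_def by (rule R)
  qed
  have large: "\<forall>\<^sub>F n in sequentially. M < real n * Re (s n)" for M
    using growth unfolding filterlim_at_top_dense by blast

  show w': "w' = 0"
  proof (rule ccontr)
    assume w': "w' \<noteq> 0"
    have "\<forall>\<^sub>F n in sequentially. real n \<ge> 2 * \<bar>a\<bar> * N / w'\<^sup>2"
      using eventually_ge_at_top[of "nat \<lceil>2 * \<bar>a\<bar> * N / w'\<^sup>2\<rceil>"]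
      by eventually_elim linarith
    \<comment> \<open>For such \<open>n\<close>, half of \<open>real n * w'\<^sup>2\<close> absorbs
      \<open>a * N\<close>. The first threshold makes the other half, times \<open>X\<close>, exceed
      the term with \<open>Im (s n)\<close>, which is at most
      \<open>real n * \<bar>w' * a1\<bar> * R\<close>.\<close>
    with basic bounded large[of "\<bar>a0\<bar> + 2 * \<bar>w' * a1\<bar> * R / w'\<^sup>2"] large[of "\<bar>a0\<bar>"]
    have "\<forall>\<^sub>F n in sequentially. False"
    proof eventually_elim
      case (elim n)
      define X where "X = real n * Re (s n) - a0"
      have X: "X > 0" "X > 2 * \<bar>w' * a1\<bar> * R / w'\<^sup>2"
        using elim unfolding X_def by linarith+
      have n: "real n > 0" using elim by simp
      have "2 * \<bar>a\<bar> * N \<le> real n * w'\<^sup>2"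
        using elim(5) w' by (simp add: field_simps)
      moreover have "a * N \<le> \<bar>a\<bar> * N"
        using pos(3) by (intro mult_right_mono) auto
      ultimately have "a * N - real n * w'\<^sup>2 \<le> - (real n * w'\<^sup>2 / 2)"
        by linarith
      then have "(a * N - real n * w'\<^sup>2) * X \<le> - (real n * w'\<^sup>2 / 2) * X"
        using X by (intro mult_right_mono) auto
      moreover have "real n * w' * a1 * Im (s n) \<le> real n * (\<bar>w' * a1\<bar> * R)"
      proof -
        have "\<bar>Im (s n)\<bar> \<le> R"
          using elim(2) abs_Im_le_cmod[of "s n"] by linarith
        then have "\<bar>w' * a1\<bar> * \<bar>Im (s n)\<bar> \<le> \<bar>w' * a1\<bar> * R"
          by (intro mult_left_mono) auto
        moreover have "w' * a1 * Im (s n) \<le> \<bar>w' * a1\<bar> * \<bar>Im (s n)\<bar>"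
          by (metis abs_ge_self abs_mult)
        ultimately show ?thesis
          using n by (simp add: mult.assoc)
      qed
      moreover have "0 < (a * N - real n * w'\<^sup>2) * X + real n * w' * a1 * Im (s n)"
        using elim(1) unfolding X_def by blast
      ultimately have "0 < - (real n * w'\<^sup>2 / 2) * X + real n * (\<bar>w' * a1\<bar> * R)"
        by linarith
      also have "\<dots> = real n * (\<bar>w' * a1\<bar> * R - w'\<^sup>2 / 2 * X)"
        by (simp add: algebra_simps)
      finally have "0 < real n * (\<bar>w' * a1\<bar> * R - w'\<^sup>2 / 2 * X)" .
      then have "w'\<^sup>2 / 2 * X < \<bar>w' * a1\<bar> * R"
        using n by (simp add: zero_less_mult_iff)
      with X(2) w' show False
        by (simp add: field_simps)
    qed
    then show False by simp
  qed

  show a: "a > 0"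
  proof -
    have "\<forall>\<^sub>F n in sequentially. a > 0"
      using basic large[of "a0"]
    proof eventually_elim
      case (elim n)
      then have "a * N * (real n * Re (s n) - a0) > 0" using w' by simp
      with elim(2) pos(3) show "a > 0" by (simp add: zero_less_mult_iff)
    qed
    then show ?thesis by simp
  qed

  show "w = 0"
  proof (rule ccontr)
    assume w: "w \<noteq> 0"
    then have A': "A > \<rho> * c\<^sup>2" using pos by simp
    \<comment> \<open>The constant value of \<open>A * P n - \<rho> * Q n\<close>. Its positivity
      prevents \<open>P n\<close> and \<open>Q n\<close> from being small together.\<close>
    define \<Delta> where "\<Delta> = w\<^sup>2 * (A - \<rho> * c\<^sup>2)"
    have \<Delta>: "\<Delta> > 0" using w A' by (simp add: \<Delta>_def)
    \<comment> \<open>With \<open>w' = 0\<close> the factor \<open>\<kappa> n\<close> is the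
      constant \<open>a * N\<close>, so \<open>n\<^sup>2\<close> now survives on the left while the
      right-hand side is bounded through \<open>R\<close>.\<close>
    define M where "M = 4 * (a * N)\<^sup>2 * (\<rho> * \<bar>R\<bar> ^ 4 + N\<^sup>2 * (A * \<bar>R\<bar>\<^sup>2 + c\<^sup>2 * w\<^sup>2)) / N\<^sup>2"
    have M: "\<forall>\<^sub>F n in sequentially. n > 0 \<and> Re (s n) > 0 \<and> (cmod (P n))\<^sup>2 * (real n)\<^sup>2 * cmod (Q n) \<le> M"
      using basic bounded
    proof eventually_elim
      case (elim n)
      then have r: "cmod (s n) \<le> \<bar>R\<bar>" by simp
      have "cmod (Q n) \<le> A * (cmod (s n))\<^sup>2 + c\<^sup>2 * w\<^sup>2"
        unfolding Q_def using norm_triangle_ineq[of "of_real A * (s n)\<^sup>2" "of_real (c\<^sup>2 * w\<^sup>2)"] A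
        by (simp add: norm_mult norm_power)
      also have "\<dots> \<le> A * \<bar>R\<bar>\<^sup>2 + c\<^sup>2 * w\<^sup>2"
        using r A by (intro add_right_mono mult_left_mono power_mono) auto
      finally have "N\<^sup>2 * cmod (Q n) \<le> N\<^sup>2 * (A * \<bar>R\<bar>\<^sup>2 + c\<^sup>2 * w\<^sup>2)"
        by (intro mult_left_mono) auto
      moreover have "\<rho> * cmod (s n) ^ 4 \<le> \<rho> * \<bar>R\<bar> ^ 4"
        using r pos(1) by (intro mult_left_mono power_mono) auto
      ultimately have "4 * (a * N)\<^sup>2 * (\<rho> * cmod (s n) ^ 4 + N\<^sup>2 * cmod (Q n))
          \<le> 4 * (a * N)\<^sup>2 * (\<rho> * \<bar>R\<bar> ^ 4 + N\<^sup>2 * (A * \<bar>R\<bar>\<^sup>2 + c\<^sup>2 * w\<^sup>2))"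
        by (intro mult_left_mono) auto
      moreover have "(cmod (\<kappa> n))\<^sup>2 = (a * N)\<^sup>2"
        by (simp add: \<kappa>_def w' norm_mult power_mult_distrib)
      ultimately have "(cmod (P n))\<^sup>2 * (real n)\<^sup>2 * N\<^sup>2 * cmod (Q n)
          \<le> 4 * (a * N)\<^sup>2 * (\<rho> * \<bar>R\<bar> ^ 4 + N\<^sup>2 * (A * \<bar>R\<bar>\<^sup>2 + c\<^sup>2 * w\<^sup>2))"
        using elim by simp
      then show ?case
        using elim pos(3) unfolding M_def by (simp add: pos_le_divide_eq mult_ac)
    qed
    define \<delta>Q where "\<delta>Q = \<Delta> / (2 * \<rho>)"
    define \<delta>P where "\<delta>P = \<Delta> / (2 * A)"
    have \<delta>: "\<delta>Q > 0" "\<delta>P > 0"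
      using \<Delta> A pos by (simp_all add: \<delta>Q_def \<delta>P_def)
    define p where "p = sqrt (\<rho> * w\<^sup>2)"
    define q where "q = sqrt (A * (c\<^sup>2 * w\<^sup>2))"
    have pq: "p > 0" "q > 0"
      using pos A w by (simp_all add: p_def q_def)
    \<comment> \<open>Threshold for \<open>real n * Re (s n)\<close>: the two quotients exceed
      \<open>M\<close> in the two cases below, and the 1 gives \<open>X > 1\<close>.\<close>
    define B where "B = 1 + \<bar>M\<bar> / (p\<^sup>2 * \<delta>Q) + \<bar>M\<bar> / (\<delta>P\<^sup>2 * q)"
    have "\<forall>\<^sub>F n in sequentially. False"
      using M large[of B]
    proof eventually_elim
      case (elim n)
      define X where "X = real n * Re (s n)"
      have nonneg: "\<bar>M\<bar> / (p\<^sup>2 * \<delta>Q) \<ge> 0" "\<bar>M\<bar> / (\<delta>P\<^sup>2 * q) \<ge> 0"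
        using pq \<delta> by simp_all
      with elim(2) have X: "X > 1" "X > \<bar>M\<bar> / (p\<^sup>2 * \<delta>Q)" "X > \<bar>M\<bar> / (\<delta>P\<^sup>2 * q)"
        unfolding B_def X_def by linarith+
      then have XM: "X * (p\<^sup>2 * \<delta>Q) > \<bar>M\<bar>" "X * (\<delta>P\<^sup>2 * q) > \<bar>M\<bar>"
        using pq \<delta> by (simp_all add: pos_divide_less_eq)
      have n: "real n \<ge> 1" and s: "Re (s n) > 0"
        using elim by auto
      have geP: "p * Re (s n) \<le> cmod (P n)"
        unfolding p_def P_def using norm_quadratic_ge[OF s pos(1), of "w\<^sup>2"] by simp
      have geQ: "q * Re (s n) \<le> cmod (Q n)"
        unfolding q_def Q_def using norm_quadratic_ge[OF s A, of "c\<^sup>2 * w\<^sup>2"] by simp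
      have "of_real \<Delta> = of_real A * P n - of_real \<rho> * Q n"
        by (simp add: \<Delta>_def P_def Q_def algebra_simps)
      then have "\<Delta> \<le> A * cmod (P n) + \<rho> * cmod (Q n)"
        using norm_triangle_ineq4[of "of_real A * P n" "of_real \<rho> * Q n"] A pos(1) \<Delta>
        by (metis abs_of_pos norm_mult norm_of_real)
      then consider "\<delta>Q \<le> cmod (Q n)" | "\<delta>P \<le> cmod (P n)"
        unfolding \<delta>Q_def \<delta>P_def using A pos(1) by (force simp: field_simps)
      then show False
      proof cases
        case 1
        \<comment> \<open>With \<open>Q n\<close> bounded away from 0, the square of
          \<open>P n\<close> supplies two factors \<open>Re (s n)\<close>, which combine with
          \<open>n\<^sup>2\<close> to \<open>X\<^sup>2\<close>.\<close>
        have "(p * Re (s n))\<^sup>2 * (real n)\<^sup>2 * \<delta>Q \<le> (cmod (P n))\<^sup>2 * (real n)\<^sup>2 * cmod (Q n)"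
          using geP pq s 1 \<delta> by (intro mult_mono power_mono) auto
        also have "\<dots> \<le> M" using elim by simp
        finally have "X * (X * (p\<^sup>2 * \<delta>Q)) \<le> M"
          by (simp add: X_def power_mult_distrib power2_eq_square mult_ac)
        moreover have "1 * (X * (p\<^sup>2 * \<delta>Q)) \<le> X * (X * (p\<^sup>2 * \<delta>Q))"
          using X \<delta> by (intro mult_right_mono) auto
        ultimately show False using XM by linarith
      next
        case 2
        \<comment> \<open>Here \<open>Q n\<close> supplies only one factor \<open>Re (s n)\<close>;
          the spare \<open>n\<close> is at least 1.\<close>
        have "\<delta>P\<^sup>2 * (real n)\<^sup>2 * (q * Re (s n)) \<le> (cmod (P n))\<^sup>2 * (real n)\<^sup>2 * cmod (Q n)"
          using geQ pq s 2 \<delta> by (intro mult_mono power_mono) auto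
        also have "\<dots> \<le> M" using elim by simp
        finally have "real n * (X * (\<delta>P\<^sup>2 * q)) \<le> M"
          by (simp add: X_def power2_eq_square mult_ac)
        moreover have "1 * (X * (\<delta>P\<^sup>2 * q)) \<le> real n * (X * (\<delta>P\<^sup>2 * q))"
          using X n pq by (intro mult_right_mono) auto
        ultimately show False using XM by linarith
      qed
    qed
    then show False by simp
  qed
qed

section \<open>Sufficiency: explicit growing modes\<close>

text \<open>The dispersion relation for \<open>w = w' = 0\<close> and real \<open>s\<close>, with
  the decaying root for \<open>lp\<close> inserted and a factor \<open>s\<close> divided out. The
  difference of its sides is negative at 0 and the quadratic side wins for large
  \<open>s\<close>.\<close>

lemma rayleigh_taylor_root:
  fixes n :: nat and \<rho> A N a a0 :: real
  assumes "\<rho> > 0" "A > 0" "N > 0" "a > 0" "n > 0"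
  obtains s :: real where "0 < s"
    "\<rho> * s * (real n * s - a0) = a * sqrt (N\<^sup>2 + \<rho> * s\<^sup>2 / A)"
proof -
  define f where "f s = \<rho> * s * (real n * s - a0) - a * sqrt (N\<^sup>2 + \<rho> * s\<^sup>2 / A)" for s
  define b where "b = sqrt (\<rho> / A)"
  \<comment> \<open>Chosen independently of \<open>n\<close>: \<open>S \<ge> 1\<close> bounds the
    square root by \<open>(N + b) * S\<close>, and the other summands give
    \<open>S - a0 \<ge> a * (N + b) / \<rho>\<close>.\<close>
  define S where "S = 1 + \<bar>a0\<bar> + a * (N + b) / \<rho>"
  have b: "b \<ge> 0" using assms by (simp add: b_def)
  have S: "S \<ge> 1" using assms b by (simp add: S_def)
  have "sqrt (N\<^sup>2 + \<rho> * S\<^sup>2 / A) \<le> sqrt (N\<^sup>2) + sqrt (\<rho> * S\<^sup>2 / A)"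
    using assms by (intro sqrt_add_le_add_sqrt) auto
  also have "\<dots> = N + b * S"
    using assms S by (simp add: b_def real_sqrt_mult real_sqrt_divide)
  also have "\<dots> \<le> (N + b) * S"
    using assms S by (simp add: algebra_simps)
  finally have "a * sqrt (N\<^sup>2 + \<rho> * S\<^sup>2 / A) \<le> a * ((N + b) * S)"
    using assms by (intro mult_left_mono) auto
  also have "\<dots> = \<rho> * S * (a * (N + b) / \<rho>)"
    using assms by simp
  also have "\<dots> \<le> \<rho> * S * (real n * S - a0)"
  proof (intro mult_left_mono)
    have "1 * S \<le> real n * S"
      using assms S by (intro mult_right_mono) auto
    moreover have "a * (N + b) / \<rho> \<le> S - a0"
      unfolding S_def by linarith
    ultimately show "a * (N + b) / \<rho> \<le> real n * S - a0"
      by linarith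
  qed (use assms S in auto)
  finally have "f S \<ge> 0" by (simp add: f_def)
  moreover have "f 0 < 0"
    using assms by (simp add: f_def)
  moreover have "continuous_on {0..S} f"
    unfolding f_def by (intro continuous_intros) (use assms in auto)
  ultimately obtain s where s: "0 \<le> s" "s \<le> S" "f s = 0"
    using IVT'[of f 0 0 S] S by auto
  with \<open>f 0 < 0\<close> have "s > 0" by (cases "s = 0") auto
  with s(3) show ?thesis
    by (intro that) (auto simp: f_def)
qed

text \<open>If \<open>X = n * s n\<close> were at most \<open>M\<close>, then \<open>n\<close> times
  the left side of \<open>root\<close>, which is \<open>\<rho> * X * (X - a0)\<close>, would be
  bounded, while \<open>n\<close> times the right side is at least \<open>n * a * N\<close>.\<close>

lemma rayleigh_taylor_growth:
  fixes s :: "nat \<Rightarrow> real" and \<rho> A N a a0 :: real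
  assumes "\<rho> > 0" "A > 0" "N > 0" "a > 0"
    and "\<And>n. n > 0 \<Longrightarrow> 0 < s n"
    and root: "\<And>n. n > 0 \<Longrightarrow> \<rho> * s n * (real n * s n - a0) = a * sqrt (N\<^sup>2 + \<rho> * (s n)\<^sup>2 / A)"
  shows "filterlim (\<lambda>n. real n * s n) at_top sequentially"
  unfolding filterlim_at_top_dense
proof
  fix M :: real
  define L where "L = \<bar>M\<bar> * (\<bar>M\<bar> + \<bar>a0\<bar>)"
  have "\<forall>\<^sub>F n in sequentially. L * \<rho> / (a * N) < real n"
    by (rule filterlim_at_top_dense[THEN iffD1, OF filterlim_real_sequentially, rule_format])
  then show "\<forall>\<^sub>F n in sequentially. M < real n * s n"
    using eventually_gt_at_top[of 0]
  proof eventually_elim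
    case (elim n)
    note n = elim(2)
    show ?case
    proof (rule ccontr)
      assume "\<not> M < real n * s n"
      define X where "X = real n * s n"
      have X: "0 < X" "X \<le> \<bar>M\<bar>"
        using \<open>\<not> M < real n * s n\<close> assms(5)[OF n] n by (auto simp: X_def)
      have "N = sqrt (N\<^sup>2)" using assms by simp
      also have "\<dots> \<le> sqrt (N\<^sup>2 + \<rho> * (s n)\<^sup>2 / A)"
        using assms by (intro real_sqrt_le_mono) auto
      finally have "a * N \<le> \<rho> * s n * (X - a0)"
        using root[OF n] assms by (simp add: X_def)
      then have "real n * (a * N) \<le> real n * (\<rho> * s n * (X - a0))"
        by (intro mult_left_mono) auto
      also have "\<dots> = \<rho> * (X * (X - a0))"
        by (simp add: X_def)
      also have "\<dots> \<le> \<rho> * L"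
      proof (rule mult_left_mono)
        have "X * (X - a0) \<le> X * (\<bar>M\<bar> + \<bar>a0\<bar>)"
          using X by (intro mult_left_mono) auto
        also have "\<dots> \<le> L"
          unfolding L_def using X by (intro mult_right_mono) auto
        finally show "X * (X - a0) \<le> L" .
      qed (use assms in simp)
      finally have "real n \<le> L * \<rho> / (a * N)"
        using assms by (simp add: field_simps)
      with elim(1) show False by simp
    qed
  qed
qed

text \<open>Normalized by \<open>\<phi> = 1\<close>, the interface conditions give \<open>q\<close>,
  \<open>v $ 1\<close> and \<open>\<xi>\<close>. The tangential velocity then follows from the
  momentum equation and the magnetic field from the induction equation, which makes it parallel to
  the plasma field.\<close>

lemma rayleigh_taylor_mode:
  fixes C :: fc_coeffs and \<omega> :: "real^2" and s :: real
  defines "A \<equiv> (H2_hat C)\<^sup>2 + (H3_hat C)\<^sup>2 + rho_hat C * (c_hat C)\<^sup>2"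
    and "N \<equiv> norm \<omega>"
  defines "\<mu> \<equiv> sqrt (N\<^sup>2 + rho_hat C * s\<^sup>2 / A)"
  assumes pos: "rho_hat C > 0" "c_hat C > 0" "\<omega> \<noteq> 0" "s > 0" "n > 0"
    and w: "H2_hat C * \<omega> $ 1 + H3_hat C * \<omega> $ 2 = 0"
      "calH2_hat C * \<omega> $ 1 + calH3_hat C * \<omega> $ 2 = 0"
    and root: "rho_hat C * s * (real n * s - a0_hat C) = a_hat C * \<mu>"
  shows "mode_eqs C \<omega> n (of_real s) (of_real (- \<mu>)) (of_real N) (of_real (a_hat C))
    (vector [of_real (real n * s - a0_hat C),
       - \<i> * of_real (\<omega> $ 1 * a_hat C / (rho_hat C * s)),
       - \<i> * of_real (\<omega> $ 2 * a_hat C / (rho_hat C * s))])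
    (of_real (a_hat C / A) *s vector [0, of_real (H2_hat C), of_real (H3_hat C)])
    (of_real (a1_hat C / (real n * N))) 1"
    (is "mode_eqs C \<omega> n ?s ?lp ?lm ?q ?v ?h ?\<xi> 1")
proof -
  let ?r = "rho_hat C" and ?a = "a_hat C"
  define D where "D = (\<Sum>j\<in>UNIV. wave_grad ?lp \<omega> $ j * ?v $ j)"
  have A: "A > 0"
    using pos by (simp add: A_def add_nonneg_pos)
  have N: "N > 0" "N\<^sup>2 = (\<omega> $ 1)\<^sup>2 + (\<omega> $ 2)\<^sup>2"
    using pos unfolding N_def power2_norm_eq_inner
    by (simp_all add: inner_vec_def sum_2 power2_eq_square)
  have \<mu>: "\<mu>\<^sup>2 = N\<^sup>2 + ?r * s\<^sup>2 / A"
    unfolding \<mu>_def using A pos by (intro real_sqrt_pow2) auto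
  have v1: "real n * s - a0_hat C = ?a * \<mu> / (?r * s)"
    using root pos by (simp add: field_simps)
  \<comment> \<open>The root equation and
    \<open>\<mu>\<^sup>2 - N\<^sup>2 = rho_hat C * s\<^sup>2 / A\<close> collapse the divergence to
    the value that balances the energy and induction equations.\<close>
  have "D = of_real (- \<mu> * (real n * s - a0_hat C) + N\<^sup>2 * ?a / (?r * s))"
    unfolding N D_def by (simp add: sum_3 vector_3 power2_eq_square add_divide_distrib algebra_simps)
  also have "- \<mu> * (real n * s - a0_hat C) + N\<^sup>2 * ?a / (?r * s) = - (\<mu>\<^sup>2 - N\<^sup>2) * ?a / (?r * s)"
    unfolding v1 using pos by (simp add: field_simps power2_eq_square)
  also have "\<dots> = - s * ?a / A"
    unfolding \<mu> using A pos by (simp add: field_simps power2_eq_square)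
  finally have D: "D = of_real (- s * ?a / A)" .
  have h: "?h $ 1 = 0" "?h $ 2 = of_real (?a / A * H2_hat C)" "?h $ 3 = of_real (?a / A * H3_hat C)"
    by (simp_all add: vector_3)
  have "s * (?a - H2_hat C * (?a / A * H2_hat C) - H3_hat C * (?a / A * H3_hat C))
      + ?r * (c_hat C)\<^sup>2 * (- s * ?a / A)
    = s * ?a / A * (A - ((H2_hat C)\<^sup>2 + (H3_hat C)\<^sup>2 + ?r * (c_hat C)\<^sup>2))"
    using A by (simp add: field_simps power2_eq_square)
  also have "\<dots> = 0"
    by (simp add: A_def)
  finally have e0: "?s * (?q - of_real (H2_hat C) * ?h $ 2 - of_real (H3_hat C) * ?h $ 3)
      + of_real (?r * (c_hat C)\<^sup>2) * D = 0"
    unfolding D h by (simp only: of_real_add[symmetric] of_real_mult[symmetric]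
        of_real_diff[symmetric] of_real_eq_0_iff)
  have mom: "of_real ?r * ?s * ?v $ k + wave_grad ?lp \<omega> $ k * ?q = 0" for k
  proof -
    have "of_real ?r * ?s * of_real (real n * s - a0_hat C) = ?q * of_real \<mu>"
      using root by (simp only: of_real_mult[symmetric])
    then show ?thesis
      using exhaust_3[of k] pos by (auto simp: vector_3 field_simps)
  qed
  have ind: "?s * ?h $ k + of_real (H_hat C $ k) * D = 0" for k
    unfolding D H_hat_def using exhaust_3[of k] A by (auto simp: vector_3 field_simps)
  show ?thesis
    unfolding mode_eqs_def Let_def D_def[symmetric] w N_def[symmetric]
    using e0 mom ind N(1) pos(5) by (simp add: vector_3)
qed

section \<open>Both directions of the criterion for ill-posedness\<close>

theorem theorem2p2:
  fixes C :: fc_coeffs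
  assumes "rho_hat C > 0" and "c_hat C > 0"
  shows "FC_ill_posed C \<longleftrightarrow>
    H2_hat C * calH3_hat C - H3_hat C * calH2_hat C = 0 \<and> jump_dq C < 0"
proof
  define A where "A = (H2_hat C)\<^sup>2 + (H3_hat C)\<^sup>2 + rho_hat C * (c_hat C)\<^sup>2"
  have A: "A > 0"
    using assms by (simp add: A_def add_nonneg_pos)
  {
    assume "FC_ill_posed C"
    then obtain \<omega> s lp lm qb vb Hb \<xi>b \<phi>b where ex: "hadamard_example C \<omega> s lp lm qb vb Hb \<xi>b \<phi>b"
      unfolding FC_ill_posed_def by blast
    then have \<omega>: "\<omega> \<noteq> 0" and growth: "filterlim (\<lambda>n. real n * Re (s n)) at_top sequentially"
      unfolding hadamard_example_def by blast+
    define w where "w = H2_hat C * \<omega> $ 1 + H3_hat C * \<omega> $ 2"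
    define w' where "w' = calH2_hat C * \<omega> $ 1 + calH3_hat C * \<omega> $ 2"
    have large: "\<forall>\<^sub>F n in sequentially. \<bar>a0_hat C\<bar> < real n * Re (s n)"
      using growth unfolding filterlim_at_top_dense by blast
    have "\<forall>\<^sub>F n in sequentially.
        Re (s n) > 0 \<and> Re (lp n) < 0 \<and> Re (lm n) > 0 \<and>
        \<not> (qb n = 0 \<and> vb n = 0 \<and> Hb n = 0 \<and> \<xi>b n = 0 \<and> \<phi>b n = 0) \<and>
        FC_solution C
          (\<lambda>t x. qb n * wave_exp n (s n) (lp n) \<omega> t x)
          (\<lambda>t x. \<chi> k. vb n $ k * wave_exp n (s n) (lp n) \<omega> t x)
          (\<lambda>t x. \<chi> k. Hb n $ k * wave_exp n (s n) (lp n) \<omega> t x)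
          (\<lambda>t x. \<xi>b n * wave_exp n (s n) (lm n) \<omega> t x)
          (\<lambda>t y. \<phi>b n * wave_exp_tan n (s n) \<omega> t y)"
      using ex unfolding hadamard_example_def by blast
    then have ev: "\<forall>\<^sub>F n in sequentially. Re (s n) > 0 \<and>
      (of_real (rho_hat C) * (s n)\<^sup>2 + of_real (w\<^sup>2)) * (of_nat n * s n - of_real (a0_hat C)) * of_real (norm \<omega>)
        + s n * lp n * (of_real (a_hat C * norm \<omega> - real n * w'\<^sup>2) + \<i> * of_real (w' * a1_hat C)) = 0 \<and>
      of_real (rho_hat C) * s n ^ 4
        = (of_real A * (s n)\<^sup>2 + of_real ((c_hat C)\<^sup>2 * w\<^sup>2)) * ((lp n)\<^sup>2 - of_real ((norm \<omega>)\<^sup>2)) \<and>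
      Re ((of_real (a_hat C * norm \<omega> - real n * w'\<^sup>2) + \<i> * of_real (w' * a1_hat C))
        * cnj (of_nat n * s n - of_real (a0_hat C))) > 0"
      using large eventually_gt_at_top[of 0]
    proof eventually_elim
      case (elim n)
      then have "mode_eqs C \<omega> n (s n) (lp n) (lm n) (qb n) (vb n) (Hb n) (\<xi>b n) (\<phi>b n)"
        by (simp add: FC_solution_wave_iff)
      note disp = mode_dispersion[OF assms _ _ _ _ \<omega> _ _ this]
      show ?case
        unfolding w_def w'_def A_def using elim by (intro conjI disp) auto
    qed
    have "A > rho_hat C * (c_hat C)\<^sup>2 \<or> w = 0 \<and> A > 0"
      using A by (cases "H2_hat C = 0"; cases "H3_hat C = 0")
        (auto simp: A_def w_def add_pos_nonneg add_nonneg_pos)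
    note necessary = growing_modes_necessary[OF assms _ this growth ev]
    have "w = 0" "w' = 0" "a_hat C > 0"
      by (rule necessary, use \<omega> in simp)+
    \<comment> \<open>Cramer's rule: a nonzero \<open>\<omega>\<close> orthogonal to both fields
      forces their determinant to vanish.\<close>
    have "(H2_hat C * calH3_hat C - H3_hat C * calH2_hat C) * \<omega> $ 1 = calH3_hat C * w - H3_hat C * w'"
      "(H2_hat C * calH3_hat C - H3_hat C * calH2_hat C) * \<omega> $ 2 = H2_hat C * w' - calH2_hat C * w"
      by (simp_all add: w_def w'_def algebra_simps)
    then have "H2_hat C * calH3_hat C - H3_hat C * calH2_hat C = 0"
      using \<omega> \<open>w = 0\<close> \<open>w' = 0\<close> by (auto simp: vec_eq_iff forall_2)
    with \<open>a_hat C > 0\<close> show "H2_hat C * calH3_hat C - H3_hat C * calH2_hat C = 0 \<and> jump_dq C < 0"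
      by (simp add: a_hat_def)
  }
  {
    assume "H2_hat C * calH3_hat C - H3_hat C * calH2_hat C = 0 \<and> jump_dq C < 0"
    then have col: "H2_hat C * calH3_hat C = H3_hat C * calH2_hat C" and a: "a_hat C > 0"
      by (simp_all add: a_hat_def)
    \<comment> \<open>Collinear fields have a common normal: a nonzero one of them rotated by a
      right angle, or any direction if both vanish.\<close>
    obtain \<omega> :: "real^2" where \<omega>: "\<omega> \<noteq> 0" "H2_hat C * \<omega> $ 1 + H3_hat C * \<omega> $ 2 = 0"
      "calH2_hat C * \<omega> $ 1 + calH3_hat C * \<omega> $ 2 = 0"
    proof -
      consider "H2_hat C \<noteq> 0 \<or> H3_hat C \<noteq> 0" | "calH2_hat C \<noteq> 0 \<or> calH3_hat C \<noteq> 0"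
        | "H2_hat C = 0" "H3_hat C = 0" "calH2_hat C = 0" "calH3_hat C = 0" by blast
      then show thesis
      proof cases
        case 1
        then show thesis
          using col by (intro that[of "vector [- H3_hat C, H2_hat C]"])
            (auto simp: vec_eq_iff forall_2 algebra_simps)
      next
        case 2
        then show thesis
          using col by (intro that[of "vector [- calH3_hat C, calH2_hat C]"])
            (auto simp: vec_eq_iff forall_2 algebra_simps)
      next
        case 3
        then show thesis
          by (intro that[of "vector [1, 0]"]) (auto simp: vec_eq_iff forall_2)
      qed
    qed
    define N where "N = norm \<omega>"
    have N: "N > 0" using \<omega> by (simp add: N_def)
    have "\<exists>s. n > 0 \<longrightarrow> 0 < s \<and> rho_hat C * s * (real n * s - a0_hat C)
        = a_hat C * sqrt (N\<^sup>2 + rho_hat C * s\<^sup>2 / A)" for n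
      using rayleigh_taylor_root[OF assms(1) A N a, of n "a0_hat C"] by metis
    then obtain s where s: "\<And>n. n > 0 \<Longrightarrow> 0 < s n"
      and root: "\<And>n. n > 0 \<Longrightarrow> rho_hat C * s n * (real n * s n - a0_hat C)
        = a_hat C * sqrt (N\<^sup>2 + rho_hat C * (s n)\<^sup>2 / A)"
      by metis
    note growth = rayleigh_taylor_growth[OF assms(1) A N a s root]
    let ?\<mu> = "\<lambda>n. sqrt (N\<^sup>2 + rho_hat C * (s n)\<^sup>2 / A)"
    have mode: "\<exists>v h \<xi>. mode_eqs C \<omega> n (of_real (s n)) (of_real (- ?\<mu> n)) (of_real N)
        (of_real (a_hat C)) v h \<xi> 1" if "n > 0" for n
      using rayleigh_taylor_mode[OF assms \<omega>(1) s[OF that] that \<omega>(2,3)] root[OF that]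
      unfolding N_def A_def by blast
    then obtain v h \<xi> where mode: "\<And>n. n > 0 \<Longrightarrow>
        mode_eqs C \<omega> n (of_real (s n)) (of_real (- ?\<mu> n)) (of_real N) (of_real (a_hat C)) (v n) (h n) (\<xi> n) 1"
      by metis
    have \<mu>: "?\<mu> n > 0" for n
      using N A assms by (simp add: add_pos_nonneg)
    have "hadamard_example C \<omega> (\<lambda>n. of_real (s n)) (\<lambda>n. of_real (- ?\<mu> n)) (\<lambda>n. of_real N)
        (\<lambda>n. of_real (a_hat C)) v h \<xi> (\<lambda>n. 1)"
      unfolding hadamard_example_def
    proof (intro conjI)
      show "\<forall>\<^sub>F n in sequentially.
        Re (of_real (s n)) > 0 \<and> Re (of_real (- ?\<mu> n)) < 0 \<and> Re (of_real N) > 0 \<and>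
        \<not> (complex_of_real (a_hat C) = 0 \<and> v n = 0 \<and> h n = 0 \<and> \<xi> n = 0 \<and> (1::complex) = 0) \<and>
        FC_solution C
          (\<lambda>t x. of_real (a_hat C) * wave_exp n (of_real (s n)) (of_real (- ?\<mu> n)) \<omega> t x)
          (\<lambda>t x. \<chi> k. v n $ k * wave_exp n (of_real (s n)) (of_real (- ?\<mu> n)) \<omega> t x)
          (\<lambda>t x. \<chi> k. h n $ k * wave_exp n (of_real (s n)) (of_real (- ?\<mu> n)) \<omega> t x)
          (\<lambda>t x. \<xi> n * wave_exp n (of_real (s n)) (of_real N) \<omega> t x)
          (\<lambda>t y. 1 * wave_exp_tan n (of_real (s n)) \<omega> t y)"
        using eventually_gt_at_top[of 0]
      proof eventually_elim
        case (elim n)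
        then show ?case
          using FC_solution_wave_iff[OF elim, THEN iffD2, OF mode[OF elim]] s[OF elim] \<mu>[of n] N
          by simp
      qed
    qed (use \<omega> growth in simp_all)
    then show "FC_ill_posed C"
      unfolding FC_ill_posed_def by blast
  }
qed

end
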